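(* Let $\vartheta\in(0,\infty)$ and let $\mathcal{N}_{\vartheta^2}$ denote the centered Gaussian law on $\mathbb{R}$ with variance $\vartheta^2$. Then, as $J\to\infty$, $$F_{\mathcal{N}_{\vartheta^2}}(J)=\frac{\vartheta^2}{2J}+O\left(\frac{(\log J)^{1/2}}{J^2}\right).$$
   Context: Let $\mathbb{N}=\{1,2,\dots\}$. For a law $\mu$ on $\mathbb{R}$ with finite first moment, let $h=(h_n)_{n\in\mathbb{N}}$ be, under $\mathbb{P}_\mu$, an i.i.d. sequence of real random variables with law $\mu$. For $N\in\mathbb{N}$, $(a,b)\in\{-1,+1\}^2$ and real $J$, the partition function of the Ising chain with external field $h$ is $$Z_{N,h}^{a,b}(J):=\sum_{\substack{\sigma\in\{-1,1\}^{\{0,1,\dots,N\}}\\ \sigma_0=a,\ \sigma_N=b}}\exp\Big(-2J\sum_{n=1}^N\mathbf 1_{\{\sigma_n\ne\sigma_{n-1}\}}+\sum_{n=1}^N\sigma_nh_n\Big).$$ The free energy density $F_\mu(J)$ is the deterministic real number such that, $\mathbb{P}_\mu$-almost surely, for every $(a,b)\in\{-1,+1\}^2$, $\frac1N\log Z_{N,h}^{a,b}(J)\to F_\mu(J)$ as $N\to\infty$ (this limit exists by Kingman's subadditive ergodic theorem). *)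

theory Defs
  imports "HOL-Probability.Probability" "HOL-Library.Landau_Symbols"
begin

definition ising_Z :: "nat \<Rightarrow> (nat \<Rightarrow> real) \<Rightarrow> int \<Rightarrow> int \<Rightarrow> real \<Rightarrow> real" where
  "ising_Z N h a b J =
    (\<Sum>\<sigma> \<in> {\<sigma> \<in> {0..N} \<rightarrow>\<^sub>E {-1, 1 :: int}. \<sigma> 0 = a \<and> \<sigma> N = b}.
      exp (- 2 * J * (\<Sum>n=1..N. of_bool (\<sigma> n \<noteq> \<sigma> (n - 1)))
           + (\<Sum>n=1..N. of_int (\<sigma> n) * h n)))"

text \<open>The i.i.d. sequence \<open>(h n)\<close>, \<open>n \<ge> 1\<close>, is realised canonically as the coordinate
  sequence on the infinite product of copies of \<open>\<mu>\<close>.\<close>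

definition is_free_energy :: "real measure \<Rightarrow> real \<Rightarrow> real \<Rightarrow> bool" where
  "is_free_energy \<mu> J F \<longleftrightarrow>
    (AE h in (\<Pi>\<^sub>M n\<in>{1::nat..}. \<mu>).
      \<forall>a\<in>{-1, 1}. \<forall>b\<in>{-1, 1}. (\<lambda>N. ln (ising_Z N h a b J) / real N) \<longlonglongrightarrow> F)"

definition free_energy :: "real measure \<Rightarrow> real \<Rightarrow> real" where
  "free_energy \<mu> J = (THE F. is_free_energy \<mu> J F)"

text \<open>The second parameter of \<^const>\<open>normal_density\<close> is the standard deviation, whereas the
  argument here is the variance.\<close>

definition centered_gaussian :: "real \<Rightarrow> real measure" where
  "centered_gaussian v = density lborel (\<lambda>x. ennreal (normal_density 0 (sqrt v) x))"

end

theory Submission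
  imports Defs "HOL-Library.Discrete_Functions" "HOL-Real_Asymp.Real_Asymp"
begin

text \<open>
  Write \<open>l N\<close> for the logarithm of the ratio of the partition functions ending in \<open>+1\<close> and \<open>-1\<close>. The
  transfer matrix gives \<open>l (N + 1) = f (l N) + 2 * h (N + 1)\<close>, where \<open>f\<close> is a smoothed truncation to
  \<open>[-2J, 2J]\<close>, and the logarithm of the product of the two partition functions grows by \<open>g (l N)\<close>, where
  \<open>g\<close> is up to \<open>2 exp (-2J)\<close> the absolute value of the overshoot \<open>r l = l - f l\<close>.

  Since \<open>f\<close> is a strict contraction, the Poisson equation for \<open>g\<close> has a Lipschitz solution. It turns
  the sum of the \<open>g (l n)\<close> into a martingale plus a linear drift, so that half of the drift \<open>c\<close> is the
  free energy.

  To compute \<open>c\<close>, integrate \<open>l\<^sup>2 - (f l)\<^sup>2 = \<bar>r l\<bar> * (2 * \<bar>f l\<bar> + \<bar>r l\<bar>)\<close>. The left-hand side has mean four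
  times the variance of the noise up to a coboundary, and \<open>\<bar>f l\<bar>\<close> is close to \<open>2J\<close> whenever \<open>r l\<close> is not
  small. The error is controlled by the time spent near \<open>\<plusminus>2J\<close>, which a convex test function bounds by a
  multiple of the mean overshoot. Coboundaries disappear on evaluating at an extremal point of the
  function they come from. The resulting error term is even \<open>O(1 / J\<^sup>2)\<close>.
\<close>

section \<open>The softplus function\<close>

definition softplus :: "real \<Rightarrow> real" where
  "softplus y = ln (1 + exp y)"

lemma one_plus_exp_pos: "0 < 1 + exp (y::real)"
  by (simp add: add_pos_pos)

lemma exp_softplus: "exp (softplus y) = 1 + exp y"
  by (simp add: softplus_def one_plus_exp_pos)

lemma softplus_nonneg: "0 \<le> softplus y"
  by (simp add: softplus_def)

lemma softplus_mono: "x \<le> y \<Longrightarrow> softplus x \<le> softplus y"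
  by (simp add: softplus_def one_plus_exp_pos)

lemma softplus_le_exp: "softplus y \<le> exp y"
  unfolding softplus_def by (rule ln_add_one_self_le_self) simp

lemma softplus_minus: "softplus y - y = softplus (- y)"
proof -
  have "1 + exp y = exp y * (1 + exp (- y))"
    by (simp add: algebra_simps exp_minus_inverse)
  then show ?thesis
    using one_plus_exp_pos[of "- y"] unfolding softplus_def by (simp add: ln_mult)
qed

text \<open>With \<open>z = exp (y / 4)\<close> this is
  \<open>1 + z ^ 4 \<le> (1 + z) ^ 4 \<le> exp (4 * z)\<close>. The quarter is chosen because the
  bound is squared in \<open>overshoot_squared_le\<close> and must then match the exponent one half
  of \<open>boundary_weight\<close>.\<close>

lemma softplus_le_exp_quarter: "softplus y \<le> 4 * exp (y / 4)"
proof -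
  define z where "z = exp (y / 4)"
  have z: "0 < z" "z ^ 4 = exp y"
    by (simp_all add: z_def flip: exp_of_nat_mult)
  have "1 + z ^ 4 \<le> (1 + z) ^ 4"
    using z(1) by (simp add: power4_eq_xxxx algebra_simps)
  also have "\<dots> \<le> exp z ^ 4"
    using z(1) exp_ge_add_one_self[of z] by (intro power_mono) auto
  also have "\<dots> = exp (4 * z)"
    by (simp flip: exp_of_nat_mult)
  finally have "ln (1 + exp y) \<le> ln (exp (4 * z))"
    unfolding z(2) by (subst ln_le_cancel_iff) (auto simp: one_plus_exp_pos)
  then show ?thesis
    by (simp add: softplus_def z_def)
qed

lemma softplus_has_derivative:
  "(softplus has_real_derivative exp y / (1 + exp y)) (at y)"
  unfolding softplus_def [abs_def]
  by (rule derivative_eq_intros refl | simp add: one_plus_exp_pos)+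

lemma lipschitz_softplus: "1-lipschitz_on UNIV softplus"
proof (rule lipschitz_onI)
  fix x y :: real
  have "\<bar>softplus x - softplus y\<bar> \<le> 1 * \<bar>x - y\<bar>"
    by (rule field_differentiable_bound[of UNIV softplus "\<lambda>y. exp y / (1 + exp y)", simplified])
      (auto simp: one_plus_exp_pos softplus_has_derivative abs_of_pos)
  then show "dist (softplus x) (softplus y) \<le> 1 * dist x y"
    by (simp add: dist_real_def)
qed simp

text \<open>The product of the two shifted arguments of \<open>ln\<close> exceeds the square of the
  central one by exactly \<open>exp x * (2 * cosh t - 2)\<close>. An exact formula, unlike a Taylor
  bound, serves noise \<open>t\<close> of every size.\<close>

lemma softplus_second_difference:
  "softplus (x + t) + softplus (x - t) - 2 * softplus x
     = ln (1 + exp x * (2 * cosh t - 2) / (1 + exp x)\<^sup>2)"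
proof -
  have "(1 + exp x)\<^sup>2 + exp x * (2 * cosh t - 2) = (1 + exp (x + t)) * (1 + exp (x - t))"
    by (simp add: cosh_def field_simps power2_eq_square exp_add exp_diff exp_minus)
  then have "1 + exp x * (2 * cosh t - 2) / (1 + exp x)\<^sup>2 = (1 + exp (x + t)) * (1 + exp (x - t)) / (1 + exp x)\<^sup>2"
    using one_plus_exp_pos[of x] by (simp add: divide_simps)
  then show ?thesis
    using one_plus_exp_pos[of x] one_plus_exp_pos[of "x+t"] one_plus_exp_pos[of "x-t"]
    by (simp add: softplus_def ln_mult ln_div ln_realpow)
qed

lemma softplus_second_difference_nonneg:
  "0 \<le> softplus (x + t) + softplus (x - t) - 2 * softplus x"
  unfolding softplus_second_difference
  using cosh_real_ge_1[of t] by (intro ln_ge_zero) (simp add: zero_le_mult_iff)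

text \<open>The second difference of \<open>softplus\<close> at 0, where the fraction in
  \<open>softplus_second_difference\<close> equals \<open>(cosh t - 1) / 2\<close>.\<close>

definition convexity_gain :: "real \<Rightarrow> real" where
  "convexity_gain t = ln (1 + (cosh t - 1) / 2)"

lemma convexity_gain_nonneg: "0 \<le> convexity_gain t"
  using cosh_real_ge_1[of t] by (simp add: convexity_gain_def)

lemma convexity_gain_pos: "t \<noteq> 0 \<Longrightarrow> 0 < convexity_gain t"
proof -
  assume "t \<noteq> 0"
  then have "1 < cosh t"
    using cosh_real_ge_1[of t] cosh_real_one_iff[of t] by (auto simp: order_less_le simp del: cosh_real_one_iff)
  then show ?thesis unfolding convexity_gain_def by (intro ln_gt_zero) simp
qed

lemma convexity_gain_le: "convexity_gain t \<le> \<bar>t\<bar>"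
proof -
  have "cosh t \<le> exp \<bar>t\<bar>"
    by (auto simp: cosh_def abs_real_def)
  then have "1 + (cosh t - 1) / 2 \<le> exp \<bar>t\<bar>"
    using cosh_real_ge_1[of t] by (simp add: field_simps)
  then have "ln (1 + (cosh t - 1) / 2) \<le> ln (exp \<bar>t\<bar>)"
    using cosh_real_ge_1[of t] by (subst ln_le_cancel_iff) (auto simp: field_simps add_pos_pos)
  then show ?thesis by (simp add: convexity_gain_def)
qed

text \<open>For \<open>x \<le> 0\<close> the denominator \<open>(1 + exp x)\<^sup>2\<close> is at
  most 4, its value at 0. Since \<open>exp x \<le> 1\<close>, concavity of the logarithm then lets
  the factor \<open>exp x\<close> be pulled out.\<close>

lemma softplus_second_difference_ge:
  assumes "x \<le> 0"
  shows "exp x * convexity_gain t \<le> softplus (x + t) + softplus (x - t) - 2 * softplus x"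
proof -
  define a where "a = (cosh t - 1) / 2"
  have a: "0 \<le> a" using cosh_real_ge_1[of t] by (simp add: a_def)
  have e: "0 < exp x" "exp x \<le> 1" using assms by auto
  have "(1 + exp x)\<^sup>2 \<le> 2\<^sup>2"
    using e by (intro power_mono) auto
  then have "exp x * (2 * cosh t - 2) / 4 \<le> exp x * (2 * cosh t - 2) / (1 + exp x)\<^sup>2"
    using e cosh_real_ge_1[of t] one_plus_exp_pos[of x] by (intro divide_left_mono) (auto intro!: mult_pos_pos)
  moreover have "exp x * a = exp x * (2 * cosh t - 2) / 4"
    by (simp add: a_def)
  ultimately have *: "1 + exp x * a \<le> 1 + exp x * (2 * cosh t - 2) / (1 + exp x)\<^sup>2"
    by linarith
  have "(1 + a) powr exp x \<le> 1 + exp x * a"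
  proof -
    have "exp x * ln (1 + a) + (1 - exp x) * ln 1 \<le> ln (exp x * (1 + a) + (1 - exp x) * 1)"
      using concave_onD[OF ln_concave, of "1 - exp x" "1 + a" 1] e a
      by (simp add: algebra_simps)
    then have "exp (exp x * ln (1 + a)) \<le> exp (ln (1 + exp x * a))"
      by (simp add: algebra_simps)
    also have "\<dots> = 1 + exp x * a"
      using e a by (simp add: add_pos_nonneg)
    finally show ?thesis
      using a by (simp add: powr_def)
  qed
  with * have "exp x * ln (1 + a) \<le> ln (1 + exp x * (2 * cosh t - 2) / (1 + exp x)\<^sup>2)"
    using a e by (smt (verit, best) ln_powr ln_mono powr_gt_zero)
  then show ?thesis
    unfolding softplus_second_difference convexity_gain_def a_def .
qed

section \<open>The recursion for the logarithm of the ratio of partition functions\<close>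

definition overshoot :: "real \<Rightarrow> real \<Rightarrow> real" where
  "overshoot J x = softplus (x - 2 * J) - softplus (- x - 2 * J)"

definition ratio_map :: "real \<Rightarrow> real \<Rightarrow> real" where
  "ratio_map J x = x - overshoot J x"

definition growth :: "real \<Rightarrow> real \<Rightarrow> real" where
  "growth J x = softplus (x - 2 * J) + softplus (- x - 2 * J)"

text \<open>A convex test function that bends near the two ends \<open>2 * J\<close> and
  \<open>- 2 * J\<close>. The arguments are halved so that a step \<open>2 * t\<close> moves them by
  \<open>t\<close>; the resulting second difference is then comparable to
  \<open>boundary_weight\<close>.\<close>

definition potential :: "real \<Rightarrow> real \<Rightarrow> real" where
  "potential J x = softplus ((x - 2 * J) / 2) + softplus ((- x - 2 * J) / 2)"

definition boundary_weight :: "real \<Rightarrow> real \<Rightarrow> real" where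
  "boundary_weight J x = exp ((\<bar>x\<bar> - 2 * J) / 2)"

section \<open>Symmetry, range and contraction of the ratio map\<close>

lemma overshoot_minus: "overshoot J (- x) = - overshoot J x"
  by (simp add: overshoot_def)

lemma ratio_map_minus: "ratio_map J (- x) = - ratio_map J x"
  by (simp add: ratio_map_def overshoot_minus)

lemma growth_minus: "growth J (- x) = growth J x"
  by (simp add: growth_def)

lemma growth_nonneg: "0 \<le> growth J x"
  by (simp add: growth_def softplus_nonneg)

text \<open>Reduces estimates about even and odd functions to nonnegative arguments, where the
  absolute values disappear.\<close>

lemma abs_real_wlog [case_names minus nonneg]:
  fixes P :: "real \<Rightarrow> bool"
  assumes "\<And>x. P x \<Longrightarrow> P (- x)" "\<And>x. 0 \<le> x \<Longrightarrow> P x"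
  shows "P x"
  using assms by (metis add.inverse_inverse linear neg_le_0_iff_le)

text \<open>On the ratio \<open>z = exp x\<close> itself, the transfer matrix with off-diagonal
  weight \<open>q = exp (- 2 * J)\<close> acts as the Moebius map sending \<open>z\<close> to
  \<open>(z + q) / (1 + q * z)\<close>.\<close>

lemma exp_ratio_map:
  "exp (ratio_map J x) = (exp x + exp (- 2 * J)) / (1 + exp (x - 2 * J))"
proof -
  have "exp (ratio_map J x) = exp x * exp (softplus (- x - 2 * J)) / exp (softplus (x - 2 * J))"
    by (simp add: ratio_map_def overshoot_def exp_add exp_diff)
  also have "\<dots> = (exp x + exp (- 2 * J)) / (1 + exp (x - 2 * J))"
    by (simp add: exp_softplus distrib_left flip: exp_add)
  finally show ?thesis .
qed

lemma overshoot_nonneg: "0 \<le> x \<Longrightarrow> 0 \<le> overshoot J x"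
  by (simp add: overshoot_def softplus_mono)

lemma ratio_map_bounds:
  assumes "0 \<le> x" "0 \<le> J"
  shows "0 \<le> ratio_map J x" "ratio_map J x \<le> 2 * J"
proof -
  have e: "exp (- 2 * J) \<le> 1" "1 \<le> exp x" using assms by auto
  have "0 \<le> (exp x - 1) * (1 - exp (- 2 * J))"
    using e by (intro mult_nonneg_nonneg) auto
  then have "1 + exp (x - 2 * J) \<le> exp x + exp (- 2 * J)"
    by (simp add: algebra_simps flip: exp_add)
  then have "exp 0 \<le> exp (ratio_map J x)"
    unfolding exp_ratio_map using one_plus_exp_pos by (simp add: field_simps)
  then show "0 \<le> ratio_map J x" by (simp only: exp_le_cancel_iff)
  have "exp (- 2 * J) \<le> exp (2 * J)" using assms by simp
  then have "exp x + exp (- 2 * J) \<le> exp (2 * J) * (1 + exp (x - 2 * J))"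
    by (simp add: algebra_simps flip: exp_add)
  then have "exp (ratio_map J x) \<le> exp (2 * J)"
    unfolding exp_ratio_map using one_plus_exp_pos by (simp add: field_simps)
  then show "ratio_map J x \<le> 2 * J" by (simp only: exp_le_cancel_iff)
qed

lemma abs_ratio_map_le:
  assumes "0 \<le> J"
  shows "\<bar>ratio_map J x\<bar> \<le> 2 * J"
proof (induction x rule: abs_real_wlog)
  case (minus x)
  then show ?case by (simp add: ratio_map_minus)
next
  case (nonneg x)
  then show ?case using ratio_map_bounds[OF nonneg assms] by simp
qed

text \<open>This is \<open>tanh J\<close>, the derivative of \<open>ratio_map J\<close> at
  0.\<close>

definition contraction_rate :: "real \<Rightarrow> real" where
  "contraction_rate J = (1 - exp (- 2 * J)) / (1 + exp (- 2 * J))"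

lemma contraction_rate:
  assumes "0 \<le> J"
  shows "0 \<le> contraction_rate J" "contraction_rate J < 1"
  using assms by (simp_all add: contraction_rate_def one_plus_exp_pos)

lemma lipschitz_ratio_map:
  assumes "0 \<le> J"
  shows "(contraction_rate J)-lipschitz_on UNIV (ratio_map J)"
proof (rule lipschitz_onI)
  define s where "s y = exp y / (1 + exp y)" for y :: real
  define D where "D x = 1 - s (x - 2 * J) - s (- x - 2 * J)" for x
  have deriv: "(ratio_map J has_real_derivative D x) (at x)" for x
  proof -
    have 1: "((\<lambda>x. softplus (x - 2 * J)) has_real_derivative s (x - 2 * J) * 1) (at x)"
      unfolding s_def
      by (rule DERIV_chain2[OF softplus_has_derivative]) (auto intro!: derivative_eq_intros)
    have 2: "((\<lambda>x. softplus (- x - 2 * J)) has_real_derivative s (- x - 2 * J) * (- 1)) (at x)"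
      unfolding s_def
      by (rule DERIV_chain2[OF softplus_has_derivative]) (auto intro!: derivative_eq_intros)
    show ?thesis
      unfolding ratio_map_def overshoot_def D_def
      by (rule DERIV_cong[OF DERIV_diff[OF DERIV_ident DERIV_diff[OF 1 2]]]) simp
  qed
  have bound: "\<bar>D x\<bar> \<le> contraction_rate J" for x
  proof -
    define E q where "E = exp x" and "q = exp (- 2 * J)"
    have E: "0 < E" and q: "0 < q" "q \<le> 1"
      using assms by (simp_all add: E_def q_def)
    have 1: "exp (x - 2 * J) = E * q" "exp (- x - 2 * J) = q / E"
      by (simp_all add: E_def q_def exp_diff exp_minus field_simps)
    have D: "D x = E * (1 - q\<^sup>2) / ((E + q) * (1 + q * E))"
      using E q add_pos_pos[OF zero_less_one mult_pos_pos[OF E q(1)], THEN less_imp_neq] unfolding D_def s_def 1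
      by (simp add: divide_simps add_pos_pos add_eq_0_iff_both_eq_0)
         (simp add: algebra_simps power2_eq_square)
    have q2: "q\<^sup>2 \<le> 1" using q by (simp add: power_le_one)
    \<comment> \<open>This is exactly the difference of the two sides of the next inequality; it
      vanishes at \<open>E = 1\<close>, so the derivative is largest at
      \<open>x = 0\<close>.\<close>
    have "0 \<le> q * (E - 1)\<^sup>2" using q by simp
    then have 3: "E * (1 + q)\<^sup>2 \<le> (E + q) * (1 + q * E)"
      by (simp add: algebra_simps power2_eq_square)
    have "\<bar>D x\<bar> = E * (1 - q\<^sup>2) / ((E + q) * (1 + q * E))"
      unfolding D using E q q2 by (intro abs_of_nonneg) auto
    also have "\<dots> \<le> E * (1 - q\<^sup>2) / (E * (1 + q)\<^sup>2)"
      using E q q2 3 by (intro divide_left_mono) (auto intro!: mult_pos_pos add_pos_pos)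
    also have "\<dots> = (1 - q) / (1 + q)"
      using E q by (simp add: divide_simps) (simp add: algebra_simps power2_eq_square)
    finally show ?thesis by (simp add: contraction_rate_def q_def)
  qed
  fix x y :: real
  have "\<bar>ratio_map J x - ratio_map J y\<bar> \<le> contraction_rate J * \<bar>x - y\<bar>"
    by (rule field_differentiable_bound[of UNIV "ratio_map J" D, simplified]) (simp_all add: deriv bound)
  then show "dist (ratio_map J x) (ratio_map J y) \<le> contraction_rate J * dist x y"
    by (simp add: dist_real_def)
qed (simp add: assms contraction_rate)

lemma lipschitz_growth: "2-lipschitz_on UNIV (growth J)"
proof (rule lipschitz_onI)
  fix x y :: real
  show "dist (growth J x) (growth J y) \<le> 2 * dist x y"
    using lipschitz_onD[OF lipschitz_softplus, of "x - 2 * J" "y - 2 * J"]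
      lipschitz_onD[OF lipschitz_softplus, of "- x - 2 * J" "- y - 2 * J"]
    unfolding dist_real_def growth_def by (smt (verit) UNIV_I)
qed simp

lemma lipschitz_potential: "1-lipschitz_on UNIV (potential J)"
proof (rule lipschitz_onI)
  fix x y :: real
  show "dist (potential J x) (potential J y) \<le> 1 * dist x y"
    using lipschitz_onD[OF lipschitz_softplus, of "(x - 2 * J) / 2" "(y - 2 * J) / 2"]
      lipschitz_onD[OF lipschitz_softplus, of "(- x - 2 * J) / 2" "(- y - 2 * J) / 2"]
    unfolding dist_real_def potential_def by (simp add: field_simps) (smt (verit))
qed simp

section \<open>Pointwise inequalities for overshoot, growth and potential\<close>

lemma square_diff_ratio_map:
  assumes "0 \<le> J"
  shows "x\<^sup>2 - (ratio_map J x)\<^sup>2 = \<bar>overshoot J x\<bar> * (2 * \<bar>ratio_map J x\<bar> + \<bar>overshoot J x\<bar>)"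
proof (induction x rule: abs_real_wlog)
  case (minus x)
  then show ?case by (simp add: ratio_map_minus overshoot_minus)
next
  case (nonneg x)
  show ?case
    using ratio_map_bounds(1)[OF nonneg assms] overshoot_nonneg[OF nonneg, of J]
    by (simp add: ratio_map_def power2_eq_square algebra_simps)
qed

lemma abs_overshoot_le_growth: "\<bar>overshoot J x\<bar> \<le> growth J x"
  using softplus_nonneg[of "x - 2 * J"] softplus_nonneg[of "- x - 2 * J"]
  by (simp add: overshoot_def growth_def)

lemma growth_le_abs_overshoot: "growth J x \<le> \<bar>overshoot J x\<bar> + 2 * exp (- 2 * J)"
proof (induction x rule: abs_real_wlog)
  case (minus x)
  then show ?case by (simp add: growth_minus overshoot_minus)
next
  case (nonneg x)
  have "softplus (- x - 2 * J) \<le> softplus (- 2 * J)"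
    using nonneg by (intro softplus_mono) simp
  also have "\<dots> \<le> exp (- 2 * J)" by (rule softplus_le_exp)
  finally show ?case
    using overshoot_nonneg[OF nonneg, of J] by (simp add: growth_def overshoot_def)
qed

text \<open>Controls the error of replacing the absolute value of the image by \<open>2 * J\<close>.
  Within distance 1 of the end the overshoot itself suffices; farther inside, at gap
  \<open>d\<close>, the overshoot is at most \<open>2 * exp (- d)\<close>.\<close>

lemma overshoot_times_gap_le:
  assumes "0 \<le> J"
  shows "\<bar>overshoot J x\<bar> * (2 * J - \<bar>ratio_map J x\<bar>)
           \<le> \<bar>overshoot J x\<bar> + 4 * boundary_weight J (ratio_map J x)"
proof (induction x rule: abs_real_wlog)
  case (minus x)
  then show ?case by (simp add: ratio_map_minus overshoot_minus boundary_weight_def)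
next
  case (nonneg x)
  define y d R where "y = x - 2 * J" and "d = 2 * J - ratio_map J x" and "R = overshoot J x"
  have R: "0 \<le> R" "R \<le> softplus y"
    using overshoot_nonneg[OF nonneg, of J] softplus_nonneg
    by (simp_all add: R_def y_def overshoot_def)
  have d: "0 \<le> d" "d \<le> softplus (- y)"
    using ratio_map_bounds[OF nonneg assms] softplus_minus[of y] softplus_nonneg[of "- x - 2 * J"]
    by (simp_all add: d_def y_def ratio_map_def overshoot_def)
  have "R * d \<le> R + 4 * exp (- d / 2)"
  proof (cases "d \<le> 1")
    case True
    then have "R * d \<le> R * 1" using R by (intro mult_left_mono) auto
    then show ?thesis by (smt (verit) exp_gt_zero)
  next
    case False
    then have "2 \<le> exp d" using exp_ge_add_one_self[of d] by linarith
    moreover have "exp d \<le> 1 + exp (- y)"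
      using d(2) by (metis exp_softplus exp_le_cancel_iff)
    ultimately have "exp d / 2 \<le> exp (- y)" by simp
    then have "exp y \<le> 2 * exp (- d)"
      by (simp add: exp_minus field_simps)
    then have "R \<le> 2 * exp (- d)"
      using R softplus_le_exp[of y] by linarith
    then have "R * d \<le> 2 * exp (- d) * d"
      using d by (intro mult_right_mono) auto
    \<comment> \<open>Half of the exponential decay absorbs the factor \<open>d\<close>; the other
      half is the boundary weight of the image.\<close>
    also have "\<dots> = 4 * exp (- d / 2) * (d / 2 * exp (- d / 2))"
      by (simp flip: exp_add)
    also have "\<dots> \<le> 4 * exp (- d / 2) * 1"
    proof (rule mult_left_mono)
      have "d / 2 \<le> exp (d / 2)"
        using exp_ge_add_one_self[of "d / 2"] by linarith
      then show "d / 2 * exp (- d / 2) \<le> 1"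
        by (simp add: exp_minus field_simps)
    qed simp
    finally show ?thesis using R by simp
  qed
  then show ?case
    using overshoot_nonneg[OF nonneg, of J] ratio_map_bounds(1)[OF nonneg assms]
    by (simp add: R_def d_def boundary_weight_def)
qed

lemma overshoot_squared_le: "(overshoot J x)\<^sup>2 \<le> 16 * boundary_weight J x"
proof (induction x rule: abs_real_wlog)
  case (minus x)
  then show ?case by (simp add: overshoot_minus boundary_weight_def)
next
  case (nonneg x)
  have "overshoot J x \<le> 4 * exp ((x - 2 * J) / 4)"
    using softplus_le_exp_quarter[of "x - 2 * J"] softplus_nonneg[of "- x - 2 * J"]
    by (simp add: overshoot_def)
  then have "(overshoot J x)\<^sup>2 \<le> (4 * exp ((x - 2 * J) / 4))\<^sup>2"
    using overshoot_nonneg[OF nonneg] by (intro power_mono)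
  also have "\<dots> = 16 * boundary_weight J x"
    using nonneg by (simp add: power_mult_distrib boundary_weight_def flip: exp_of_nat_mult)
  finally show ?case .
qed

text \<open>In the halved variables both \<open>softplus\<close> arguments are nonpositive and move
  by \<open>t\<close>. The end nearer to \<open>x\<close> supplies the boundary weight, while the
  other has a nonnegative second difference.\<close>

lemma potential_second_difference_ge:
  assumes "\<bar>x\<bar> \<le> 2 * J"
  shows "boundary_weight J x * convexity_gain t
           \<le> potential J (x + 2 * t) + potential J (x - 2 * t) - 2 * potential J x"
proof -
  define y z where "y = (x - 2 * J) / 2" and "z = (- x - 2 * J) / 2"
  have eq: "potential J (x + 2 * t) + potential J (x - 2 * t) - 2 * potential J x
    = (softplus (y + t) + softplus (y - t) - 2 * softplus y)
      + (softplus (z + t) + softplus (z - t) - 2 * softplus z)"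
    by (simp add: potential_def y_def z_def field_simps)
  have "y \<le> 0" "z \<le> 0" using assms by (simp_all add: y_def z_def)
  note * = softplus_second_difference_ge[OF this(1), of t] softplus_second_difference_ge[OF this(2), of t]
    softplus_second_difference_nonneg[of y t] softplus_second_difference_nonneg[of z t]
  show ?thesis
  proof (cases "0 \<le> x")
    case True
    then have "boundary_weight J x = exp y" by (simp add: boundary_weight_def y_def)
    then show ?thesis using * unfolding eq by simp
  next
    case False
    then have "boundary_weight J x = exp z" by (simp add: boundary_weight_def z_def)
    then show ?thesis using * unfolding eq by simp
  qed
qed

lemma potential_diff_ratio_map: "potential J x - potential J (ratio_map J x) \<le> \<bar>overshoot J x\<bar>"
  using lipschitz_onD[OF lipschitz_potential, of x "ratio_map J x" J]
  by (simp add: dist_real_def ratio_map_def)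

section \<open>Measurability and behaviour under composition and shifts\<close>

lemma lipschitz_imp_borel_measurable:
  fixes \<phi> :: "real \<Rightarrow> real"
  shows "K-lipschitz_on UNIV \<phi> \<Longrightarrow> \<phi> \<in> borel_measurable borel"
  by (intro borel_measurable_continuous_onI lipschitz_on_continuous_on)

lemma ratio_map_measurable [measurable]: "0 \<le> J \<Longrightarrow> ratio_map J \<in> borel_measurable borel"
  by (rule lipschitz_imp_borel_measurable[OF lipschitz_ratio_map])

lemma softplus_measurable [measurable]: "softplus \<in> borel_measurable borel"
  by (rule lipschitz_imp_borel_measurable[OF lipschitz_softplus])

lemma overshoot_measurable [measurable]: "overshoot J \<in> borel_measurable borel"
  unfolding overshoot_def [abs_def] by measurable

lemma lipschitz_comp_ratio_map:
  fixes \<phi> :: "real \<Rightarrow> real"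
  assumes "0 \<le> J" "K-lipschitz_on UNIV \<phi>"
  shows "(K * contraction_rate J)-lipschitz_on UNIV (\<lambda>x. \<phi> (ratio_map J x))"
  by (rule lipschitz_on_compose2[OF lipschitz_ratio_map[OF assms(1)] lipschitz_on_subset[OF assms(2)]]) simp

lemma boundary_weight_shift: "boundary_weight J (x + 2 * t) \<le> boundary_weight J x * exp \<bar>t\<bar>"
proof -
  have "(\<bar>x + 2 * t\<bar> - 2 * J) / 2 \<le> (\<bar>x\<bar> - 2 * J) / 2 + \<bar>t\<bar>" by argo
  then show ?thesis by (simp add: boundary_weight_def flip: exp_add)
qed

section \<open>The Poisson equation\<close>

text \<open>Symmetry turns mean first differences into second differences, and the exponential
  moment controls \<open>boundary_weight\<close> after a noise step.\<close>

locale symmetric_noise = prob_space \<mu> for \<mu> :: "real measure" +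
  assumes sets_eq [measurable_cong]: "sets \<mu> = sets borel"
    and symmetric: "distr \<mu> borel uminus = \<mu>"
    and exp_moment: "integrable \<mu> (\<lambda>t. exp \<bar>t\<bar>)"
begin

lemma space_eq [simp]: "space \<mu> = UNIV"
  using sets_eq_imp_space_eq[OF sets_eq] by simp

lemma prob_UNIV [simp]: "prob UNIV = 1"
  using prob_space by simp

section \<open>Moments and Lipschitz functions of the noise\<close>

lemma integrable_abs: "integrable \<mu> (\<lambda>t. \<bar>t\<bar>)"
proof (rule Bochner_Integration.integrable_bound[OF exp_moment])
  have "\<bar>t\<bar> \<le> exp \<bar>t\<bar>" for t :: real
    using exp_ge_add_one_self[of "\<bar>t\<bar>"] by linarith
  then show "AE t in \<mu>. norm \<bar>t\<bar> \<le> norm (exp \<bar>t\<bar>)" by simp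
qed measurable

lemma integrable_square: "integrable \<mu> (\<lambda>t. t\<^sup>2)"
proof (rule Bochner_Integration.integrable_bound[of _ "\<lambda>t. 2 * exp \<bar>t\<bar>"])
  have "t\<^sup>2 \<le> 2 * exp \<bar>t\<bar>" for t :: real
    using exp_lower_Taylor_quadratic[OF abs_ge_zero, of t] abs_ge_zero[of t] unfolding power2_abs by argo
  then show "AE t in \<mu>. norm (t\<^sup>2) \<le> norm (2 * exp \<bar>t\<bar>)" by simp
qed (use exp_moment in auto)

lemma integrable_ident: "integrable \<mu> (\<lambda>t. t)"
  by (rule Bochner_Integration.integrable_bound[OF integrable_abs]) auto

lemma integral_uminus:
  assumes "\<phi> \<in> borel_measurable borel"
  shows "(\<integral>t. \<phi> (- t) \<partial>\<mu>) = (\<integral>t. \<phi> t \<partial>\<mu> :: real)"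
  using integral_distr[of uminus \<mu> borel \<phi>] assms by (simp add: symmetric)

lemma mean_zero: "(\<integral>t. t \<partial>\<mu>) = 0"
  using integral_uminus[of "\<lambda>t. t"] by simp

lemma integrable_lipschitz:
  fixes \<phi> :: "real \<Rightarrow> real"
  assumes "K-lipschitz_on UNIV \<phi>"
  shows "integrable \<mu> (\<lambda>t. \<phi> (x + 2 * t))"
proof (rule Bochner_Integration.integrable_bound[of _ "\<lambda>t. \<bar>\<phi> x\<bar> + K * (2 * \<bar>t\<bar>)"])
  show "integrable \<mu> (\<lambda>t. \<bar>\<phi> x\<bar> + K * (2 * \<bar>t\<bar>))"
    using integrable_abs by auto
  have [measurable]: "\<phi> \<in> borel_measurable borel"
    using assms by (rule lipschitz_imp_borel_measurable)
  show "(\<lambda>t. \<phi> (x + 2 * t)) \<in> borel_measurable \<mu>" by measurable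
  have "\<bar>\<phi> (x + 2 * t)\<bar> \<le> \<bar>\<phi> x\<bar> + K * (2 * \<bar>t\<bar>)" for t
    using lipschitz_onD[OF assms, of "x + 2 * t" x] by (simp add: dist_real_def abs_mult)
  then show "AE t in \<mu>. norm (\<phi> (x + 2 * t)) \<le> norm (\<bar>\<phi> x\<bar> + K * (2 * \<bar>t\<bar>))"
    unfolding real_norm_def by (intro AE_I2 order_trans[OF _ abs_ge_self])
qed

lemma lipschitz_expectation:
  fixes \<phi> :: "real \<Rightarrow> real"
  assumes "K-lipschitz_on UNIV \<phi>"
  shows "K-lipschitz_on UNIV (\<lambda>x. \<integral>t. \<phi> (x + 2 * t) \<partial>\<mu>)"
proof (rule lipschitz_onI)
  fix x y :: real
  have "\<bar>(\<integral>t. \<phi> (x + 2 * t) \<partial>\<mu>) - (\<integral>t. \<phi> (y + 2 * t) \<partial>\<mu>)\<bar>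
      = \<bar>\<integral>t. \<phi> (x + 2 * t) - \<phi> (y + 2 * t) \<partial>\<mu>\<bar>"
    by (simp add: integrable_lipschitz[OF assms])
  also have "\<dots> \<le> (\<integral>t. \<bar>\<phi> (x + 2 * t) - \<phi> (y + 2 * t)\<bar> \<partial>\<mu>)"
    by (rule integral_abs_bound)
  also have "\<dots> \<le> (\<integral>t. K * dist x y \<partial>\<mu>)"
  proof (rule integral_mono)
    fix t
    show "\<bar>\<phi> (x + 2 * t) - \<phi> (y + 2 * t)\<bar> \<le> K * dist x y"
      using lipschitz_onD[OF assms, of "x + 2 * t" "y + 2 * t"] by (simp add: dist_real_def)
  qed (auto intro!: integrable_lipschitz[OF assms])
  finally show "dist (\<integral>t. \<phi> (x + 2 * t) \<partial>\<mu>) (\<integral>t. \<phi> (y + 2 * t) \<partial>\<mu>) \<le> K * dist x y"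
    by (simp add: dist_real_def prob_space)
qed (rule lipschitz_on_nonneg[OF assms])

text \<open>The expected growth in step \<open>n + 1\<close> of the chain started at
  \<open>x\<close>, that is, the \<open>n\<close>-th power of the transition operator applied to the
  mean growth. As \<open>ratio_map\<close> contracts, the Lipschitz constants decay geometrically in
  \<open>n\<close>.\<close>

primrec growth_iter :: "real \<Rightarrow> nat \<Rightarrow> real \<Rightarrow> real" where
  "growth_iter J 0 x = (\<integral>t. growth J (x + 2 * t) \<partial>\<mu>)"
| "growth_iter J (Suc n) x = (\<integral>t. growth_iter J n (ratio_map J (x + 2 * t)) \<partial>\<mu>)"

lemma lipschitz_growth_iter:
  assumes "0 \<le> J"
  shows "(2 * contraction_rate J ^ n)-lipschitz_on UNIV (growth_iter J n)"
proof (induction n)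
  case 0
  show ?case
    using lipschitz_expectation[OF lipschitz_growth, of J] by (simp add: growth_iter.simps[abs_def])
next
  case (Suc n)
  show ?case
    using lipschitz_expectation[OF lipschitz_comp_ratio_map[OF assms Suc]]
    by (simp add: growth_iter.simps[abs_def] mult_ac)
qed

text \<open>The solution is the sum over \<open>n\<close> of \<open>V n x - V n 0\<close>, where
  \<open>V\<close> is the iterated growth. The terms \<open>V n x\<close> alone tend to
  \<open>c\<close>; subtracting the values at 0 leaves a geometrically convergent series. Applying
  the transition operator shifts the index of the first term, and the difference telescopes to the
  mean growth minus \<open>c\<close>.\<close>

theorem poisson_equation:
  assumes "0 \<le> J"
  obtains u c L where "L-lipschitz_on UNIV u"
    and "\<And>x. (\<integral>t. growth J (x + 2 * t) \<partial>\<mu>) + (\<integral>t. u (ratio_map J (x + 2 * t)) \<partial>\<mu>) = u x + c"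
proof -
  define k where "k = contraction_rate J"
  have k: "0 \<le> k" "k < 1" using contraction_rate[OF assms] by (simp_all add: k_def)
  define V where "V = growth_iter J"
  have V_lip: "\<bar>V n x - V n y\<bar> \<le> 2 * k ^ n * \<bar>x - y\<bar>" for n x y
    using lipschitz_onD[OF lipschitz_growth_iter[OF assms, of n], of x y]
    by (simp add: dist_real_def V_def k_def)
  have V_int: "integrable \<mu> (\<lambda>t. V n (ratio_map J (x + 2 * t)))" for n x
    unfolding V_def
    by (rule integrable_lipschitz[OF lipschitz_comp_ratio_map[OF assms lipschitz_growth_iter[OF assms]]])
  have geom: "summable (\<lambda>n. 2 * k ^ n * a)" for a
    using k by (intro summable_mult2 summable_mult summable_geometric) auto
  have summ: "summable (\<lambda>n. V n x - V n y)" for x y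
    by (rule summable_comparison_test[OF _ geom[of "\<bar>x - y\<bar>"]]) (use V_lip in auto)
  define u where "u x = (\<Sum>n. V n x - V n 0)" for x
  have u_lip: "(2 / (1 - k))-lipschitz_on UNIV u"
  proof (rule lipschitz_onI)
    fix x y :: real
    have "u x - u y = (\<Sum>n. V n x - V n y)"
      unfolding u_def by (subst suminf_diff[OF summ summ]) simp
    also have "\<bar>\<dots>\<bar> \<le> (\<Sum>n. 2 * k ^ n * \<bar>x - y\<bar>)"
      using summable_rabs_comparison_test[of "\<lambda>n. V n x - V n y" "\<lambda>n. 2 * k ^ n * \<bar>x - y\<bar>"] geom V_lip
      by (intro order.trans[OF summable_rabs] suminf_le) auto
    also have "\<dots> = 2 / (1 - k) * \<bar>x - y\<bar>"
      using k by (simp add: suminf_mult2[symmetric] suminf_mult suminf_geometric summable_geometric)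
    finally show "dist (u x) (u y) \<le> 2 / (1 - k) * dist x y"
      by (simp add: dist_real_def)
  qed (use k in simp)
  define c where "c = lim (\<lambda>n. V n 0)"
  \<comment> \<open>The operator takes \<open>V n\<close> to \<open>V (Suc n)\<close> and leaves the
    constant \<open>V n 0\<close> alone. Images under \<open>ratio_map\<close> lie within
    \<open>2 * J\<close> of 0, so the terms have a summable uniform bound and sum and integral may
    be exchanged.\<close>
  have Pu: "(\<lambda>n. V (Suc n) x - V n 0) sums (\<integral>t. u (ratio_map J (x + 2 * t)) \<partial>\<mu>)" for x
  proof -
    have bd: "\<bar>V n (ratio_map J y) - V n 0\<bar> \<le> 2 * k ^ n * (2 * J)" for n y
    proof -
      have "\<bar>V n (ratio_map J y) - V n 0\<bar> \<le> 2 * k ^ n * \<bar>ratio_map J y\<bar>"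
        using V_lip[of n "ratio_map J y" 0] by simp
      also have "\<dots> \<le> 2 * k ^ n * (2 * J)"
        using abs_ratio_map_le[OF assms] k by (intro mult_left_mono) auto
      finally show ?thesis .
    qed
    have "(\<lambda>n. \<integral>t. V n (ratio_map J (x + 2 * t)) - V n 0 \<partial>\<mu>)
        sums (\<integral>t. (\<Sum>n. V n (ratio_map J (x + 2 * t)) - V n 0) \<partial>\<mu>)"
    proof (rule sums_integral)
      show "AE t in \<mu>. summable (\<lambda>n. norm (V n (ratio_map J (x + 2 * t)) - V n 0))"
        using bd by (intro AE_I2 summable_comparison_test[OF _ geom[of "2 * J"]]) auto
      have "(\<integral>t. norm (V n (ratio_map J (x + 2 * t)) - V n 0) \<partial>\<mu>) \<le> (\<integral>t. 2 * k ^ n * (2 * J) \<partial>\<mu>)" for n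
        using bd by (intro integral_mono) (auto intro!: V_int)
      then show "summable (\<lambda>n. \<integral>t. norm (V n (ratio_map J (x + 2 * t)) - V n 0) \<partial>\<mu>)"
        by (intro summable_comparison_test[OF _ geom[of "2 * J"]]) (auto simp: prob_space)
    qed (simp add: V_int)
    moreover have "(\<integral>t. V n (ratio_map J (x + 2 * t)) - V n 0 \<partial>\<mu>) = V (Suc n) x - V n 0" for n
      by (subst Bochner_Integration.integral_diff[OF V_int]) (auto simp: V_def prob_space)
    ultimately show ?thesis by (simp add: u_def)
  qed
  have diff: "(\<lambda>n. V n x - V (Suc n) x) sums (u x - (\<integral>t. u (ratio_map J (x + 2 * t)) \<partial>\<mu>))" for x
    using sums_diff[OF summable_sums[OF summ[of x 0]] Pu[of x]] by (simp add: u_def)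
  \<comment> \<open>The telescoping series at \<open>x = 0\<close> shows that \<open>V n 0\<close>
    converges, which justifies the \<open>lim\<close> defining \<open>c\<close>.\<close>
  have lim0: "(\<lambda>n. V n 0) \<longlonglongrightarrow> c"
  proof -
    have "(\<lambda>N. \<Sum>n<N. V n 0 - V (Suc n) 0) \<longlonglongrightarrow> u 0 - (\<integral>t. u (ratio_map J (0 + 2 * t)) \<partial>\<mu>)"
      using diff[of 0] unfolding sums_def .
    from tendsto_diff[OF tendsto_const[of "V 0 0"] this]
    have "convergent (\<lambda>n. V n 0)"
      unfolding sum_lessThan_telescope'[of "\<lambda>n. V n 0"] by (auto simp: convergent_def)
    then show ?thesis unfolding c_def by (simp add: convergent_LIMSEQ_iff)
  qed
  have limx: "(\<lambda>n. V n x) \<longlonglongrightarrow> c" for x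
    using tendsto_add[OF lim0 summable_LIMSEQ_zero[OF summ[of x 0]]] by simp
  have "(\<integral>t. growth J (x + 2 * t) \<partial>\<mu>) + (\<integral>t. u (ratio_map J (x + 2 * t)) \<partial>\<mu>) = u x + c" for x
    using sums_unique2[OF telescope_sums'[OF limx] diff, of x] by (simp add: V_def algebra_simps)
  with u_lip that show ?thesis by blast
qed

end

section \<open>Bounds on the growth rate\<close>

context symmetric_noise
begin

definition second_moment :: real where
  "second_moment = (\<integral>t. t\<^sup>2 \<partial>\<mu>)"

definition mean_convexity_gain :: real where
  "mean_convexity_gain = (\<integral>t. convexity_gain t \<partial>\<mu>)"

lemma integrable_convexity_gain: "integrable \<mu> convexity_gain"
proof (rule Bochner_Integration.integrable_bound[OF integrable_abs])
  show "convexity_gain \<in> borel_measurable \<mu>"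
    unfolding convexity_gain_def [abs_def] cosh_def by measurable
  show "AE t in \<mu>. norm (convexity_gain t) \<le> norm \<bar>t\<bar>"
    using convexity_gain_le convexity_gain_nonneg by simp
qed

text \<open>As \<open>convexity_gain\<close> is nonnegative and vanishes only at 0, a zero mean
  would force the noise to vanish almost surely.\<close>

lemma mean_convexity_gain_pos:
  assumes "0 < second_moment"
  shows "0 < mean_convexity_gain"
proof (rule ccontr)
  assume "\<not> 0 < mean_convexity_gain"
  then have "mean_convexity_gain = 0"
    unfolding mean_convexity_gain_def
    by (intro antisym integral_nonneg_AE) (auto simp: convexity_gain_nonneg)
  then have "AE t in \<mu>. convexity_gain t = 0"
    unfolding mean_convexity_gain_def
    by (subst (asm) integral_nonneg_eq_0_iff_AE) (auto simp: integrable_convexity_gain convexity_gain_nonneg)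
  then have "AE t in \<mu>. t\<^sup>2 = 0"
    by eventually_elim (use convexity_gain_pos in force)
  then have "second_moment = 0"
    unfolding second_moment_def by (rule integral_eq_zero_AE)
  with assms show False by simp
qed

text \<open>The image of \<open>ratio_map J\<close> lies in a compact interval, on which the
  continuous function \<open>v\<close> is bounded; this covers squares and exponentials
  alike.\<close>

lemma integrable_comp_ratio_map:
  fixes v :: "real \<Rightarrow> real"
  assumes "0 \<le> J" "continuous_on UNIV v"
  shows "integrable \<mu> (\<lambda>t. v (ratio_map J (x + 2 * t)))"
proof -
  have "compact (v ` {- 2 * J..2 * J})"
    by (intro compact_continuous_image continuous_on_subset[OF assms(2)]) auto
  then have "bounded (v ` {- 2 * J..2 * J})"
    by (rule compact_imp_bounded)
  then obtain B where "\<forall>z \<in> v ` {- 2 * J..2 * J}. norm z \<le> B"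
    unfolding bounded_iff by blast
  then have B: "\<bar>v y\<bar> \<le> B" if "y \<in> {- 2 * J..2 * J}" for y
    using that by simp
  have [measurable]: "ratio_map J \<in> borel_measurable borel" "v \<in> borel_measurable borel"
    using assms by (auto intro: borel_measurable_continuous_onI)
  show ?thesis
  proof (rule integrable_const_bound[of _ B])
    have "ratio_map J y \<in> {- 2 * J..2 * J}" for y
      using abs_ratio_map_le[OF assms(1), of y] by (auto simp: abs_le_iff)
    then show "AE t in \<mu>. norm (v (ratio_map J (x + 2 * t))) \<le> B"
      using B by (intro AE_I2) (simp only: real_norm_def)
  qed measurable
qed

text \<open>Evaluate the hypothesis at a point where \<open>v\<close> attains its maximum.\<close>

lemma drift_nonpos:
  fixes v :: "real \<Rightarrow> real"
  assumes J: "0 \<le> J" and v: "continuous_on UNIV v"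
    and a: "\<And>x. \<bar>x\<bar> \<le> 2 * J \<Longrightarrow> a \<le> (\<integral>t. v (ratio_map J (x + 2 * t)) \<partial>\<mu>) - v x"
  shows "a \<le> 0"
proof -
  obtain x where x: "x \<in> {- 2 * J..2 * J}" and max: "\<And>y. y \<in> {- 2 * J..2 * J} \<Longrightarrow> v y \<le> v x"
    using continuous_attains_sup[of "{- 2 * J..2 * J}" v] J continuous_on_subset[OF v] by force
  have "ratio_map J y \<in> {- 2 * J..2 * J}" for y
    using abs_ratio_map_le[OF J, of y] by (auto simp: abs_le_iff)
  then have "(\<integral>t. v (ratio_map J (x + 2 * t)) \<partial>\<mu>) \<le> (\<integral>t. v x \<partial>\<mu>)"
    using max by (intro integral_mono integrable_comp_ratio_map[OF J v]) auto
  moreover have "\<bar>x\<bar> \<le> 2 * J" using x by (auto simp: abs_le_iff)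
  ultimately show ?thesis
    using a[of x] by simp
qed

section \<open>Integrals of one-step quantities\<close>

lemma integrable_growth: "integrable \<mu> (\<lambda>t. growth J (x + 2 * t))"
  by (rule integrable_lipschitz[OF lipschitz_growth])

lemma integrable_abs_overshoot: "integrable \<mu> (\<lambda>t. \<bar>overshoot J (x + 2 * t)\<bar>)"
proof (rule Bochner_Integration.integrable_bound[OF integrable_growth])
  show "AE t in \<mu>. norm \<bar>overshoot J (x + 2 * t)\<bar> \<le> norm (growth J (x + 2 * t))"
    using abs_overshoot_le_growth growth_nonneg by simp
qed measurable

lemma integrable_boundary_weight: "integrable \<mu> (\<lambda>t. boundary_weight J (x + 2 * t))"
proof (rule Bochner_Integration.integrable_bound[of _ "\<lambda>t. boundary_weight J x * exp \<bar>t\<bar>"])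
  show "AE t in \<mu>. norm (boundary_weight J (x + 2 * t)) \<le> norm (boundary_weight J x * exp \<bar>t\<bar>)"
    using boundary_weight_shift[of J x] by (simp add: boundary_weight_def)
  show "(\<lambda>t. boundary_weight J (x + 2 * t)) \<in> borel_measurable \<mu>"
    unfolding boundary_weight_def by measurable
qed (simp add: exp_moment)

lemma integrable_overshoot_squared: "integrable \<mu> (\<lambda>t. (overshoot J (x + 2 * t))\<^sup>2)"
proof (rule Bochner_Integration.integrable_bound[of _ "\<lambda>t. 16 * boundary_weight J (x + 2 * t)"])
  show "AE t in \<mu>. norm ((overshoot J (x + 2 * t))\<^sup>2) \<le> norm (16 * boundary_weight J (x + 2 * t))"
    using overshoot_squared_le by (simp add: boundary_weight_def)
qed (simp_all add: integrable_boundary_weight)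

lemma integrable_shifted_square: "integrable \<mu> (\<lambda>t. (x + 2 * t)\<^sup>2)"
  by (simp add: power2_sum power_mult_distrib mult_ac integrable_square integrable_ident)

lemma integral_shifted_square: "(\<integral>t. (x + 2 * t)\<^sup>2 \<partial>\<mu>) = x\<^sup>2 + 4 * second_moment"
  by (simp add: power2_sum power_mult_distrib mult_ac integrable_square integrable_ident mean_zero second_moment_def)

lemma integral_overshoot_squared_le:
  "(\<integral>t. (overshoot J (x + 2 * t))\<^sup>2 \<partial>\<mu>) \<le> 16 * (\<integral>t. exp \<bar>t\<bar> \<partial>\<mu>) * boundary_weight J x"
proof -
  have "(\<integral>t. (overshoot J (x + 2 * t))\<^sup>2 \<partial>\<mu>) \<le> (\<integral>t. 16 * (boundary_weight J x * exp \<bar>t\<bar>) \<partial>\<mu>)"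
  proof (rule integral_mono[OF integrable_overshoot_squared])
    show "(overshoot J (x + 2 * t))\<^sup>2 \<le> 16 * (boundary_weight J x * exp \<bar>t\<bar>)" for t
      using overshoot_squared_le[of J "x + 2 * t"] boundary_weight_shift[of J x t] by linarith
  qed (simp add: exp_moment)
  then show ?thesis by (simp add: mult_ac)
qed

text \<open>The potential is strictly convex near \<open>\<plusminus> 2 * J\<close> on the scale of the noise, so the time that the
  recursion spends there is paid for by the overshoot.\<close>

lemma boundary_weight_le:
  assumes J: "0 \<le> J" and x: "\<bar>x\<bar> \<le> 2 * J"
  shows "mean_convexity_gain / 2 * boundary_weight J x
    \<le> (\<integral>t. potential J (ratio_map J (x + 2 * t)) \<partial>\<mu>) - potential J x
       + (\<integral>t. \<bar>overshoot J (x + 2 * t)\<bar> \<partial>\<mu>)"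
proof -
  note int = integrable_lipschitz[OF lipschitz_potential, of J]
  have [measurable]: "potential J \<in> borel_measurable borel"
    by (rule lipschitz_imp_borel_measurable[OF lipschitz_potential])
  \<comment> \<open>Reflecting the noise turns the mean first difference of the potential into half
    of its mean second difference.\<close>
  have sym: "(\<integral>t. potential J (x - 2 * t) \<partial>\<mu>) = (\<integral>t. potential J (x + 2 * t) \<partial>\<mu>)"
    using integral_uminus[of "\<lambda>t. potential J (x + 2 * t)"] by simp
  have int': "integrable \<mu> (\<lambda>t. potential J (x - 2 * t))"
  proof -
    have "integrable (distr \<mu> borel uminus) (\<lambda>t. potential J (x + 2 * t))"
      unfolding symmetric by (rule int)
    then show ?thesis by (subst (asm) integrable_distr_eq) auto
  qed
  have cont: "continuous_on UNIV (potential J)"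
    by (rule lipschitz_on_continuous_on[OF lipschitz_potential])
  have "(\<integral>t. boundary_weight J x * convexity_gain t \<partial>\<mu>)
      \<le> (\<integral>t. potential J (x + 2 * t) + potential J (x - 2 * t) - 2 * potential J x \<partial>\<mu>)"
    using potential_second_difference_ge[OF x]
    by (intro integral_mono) (auto intro!: integrable_convexity_gain int int')
  also have "\<dots> = 2 * (\<integral>t. potential J (x + 2 * t) \<partial>\<mu>) - 2 * potential J x"
    by (simp add: int int' sym)
  finally have 1: "mean_convexity_gain / 2 * boundary_weight J x
      \<le> (\<integral>t. potential J (x + 2 * t) \<partial>\<mu>) - potential J x"
    by (simp add: mean_convexity_gain_def mult.commute)
  \<comment> \<open>Since the potential is 1-Lipschitz, passing from \<open>x + 2 * t\<close> to its
    image costs at most the overshoot.\<close>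
  have "(\<integral>t. potential J (x + 2 * t) \<partial>\<mu>)
      \<le> (\<integral>t. potential J (ratio_map J (x + 2 * t)) + \<bar>overshoot J (x + 2 * t)\<bar> \<partial>\<mu>)"
  proof (rule integral_mono[OF int])
    show "potential J (x + 2 * t) \<le> potential J (ratio_map J (x + 2 * t)) + \<bar>overshoot J (x + 2 * t)\<bar>" for t
      using potential_diff_ratio_map[of J "x + 2 * t"] by simp
  qed (auto intro!: integrable_comp_ratio_map[OF J cont] integrable_abs_overshoot)
  also have "\<dots> = (\<integral>t. potential J (ratio_map J (x + 2 * t)) \<partial>\<mu>) + (\<integral>t. \<bar>overshoot J (x + 2 * t)\<bar> \<partial>\<mu>)"
    by (rule Bochner_Integration.integral_add[OF integrable_comp_ratio_map[OF J cont] integrable_abs_overshoot])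
  finally show ?thesis using 1 by linarith
qed

text \<open>Both bounds integrate \<open>square_diff_ratio_map\<close>, trade boundary weights for
  overshoot by \<open>boundary_weight_le\<close> and compare mean overshoot with mean growth.
  Besides constants there remain differences \<open>P v x - v x\<close>; they are collected in one
  function \<open>W\<close>, to which \<open>drift_nonpos\<close> applies.\<close>

lemma growth_rate_bounds:
  assumes J: "0 \<le> J" and pos: "0 < second_moment"
    and u: "L-lipschitz_on UNIV u"
    and poisson: "\<And>x. (\<integral>t. growth J (x + 2 * t) \<partial>\<mu>) + (\<integral>t. u (ratio_map J (x + 2 * t)) \<partial>\<mu>) = u x + c"
  defines "A \<equiv> 2 + 16 / mean_convexity_gain"
    and "B \<equiv> 32 * (\<integral>t. exp \<bar>t\<bar> \<partial>\<mu>) / mean_convexity_gain"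
  shows "4 * second_moment \<le> (4 * J + B) * c"
    and "A \<le> 4 * J \<Longrightarrow> (4 * J - A) * c \<le> 4 * second_moment + (4 * J - A) * (2 * exp (- 2 * J))"
proof -
  define K where "K = (\<integral>t. exp \<bar>t\<bar> \<partial>\<mu>)"
  define \<gamma> where "\<gamma> = mean_convexity_gain / 2"
  have \<gamma>: "0 < \<gamma>" using mean_convexity_gain_pos[OF pos] by (simp add: \<gamma>_def)
  have A: "A = 2 + 8 / \<gamma>" and B: "B = 16 * K / \<gamma>"
    by (simp_all add: A_def B_def \<gamma>_def K_def)
  have K: "0 \<le> K" unfolding K_def by (intro integral_nonneg_AE) auto
  define P where "P v x = (\<integral>t. v (ratio_map J (x + 2 * t)) \<partial>\<mu>)" for v :: "real \<Rightarrow> real" and x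
  define R where "R x = (\<integral>t. \<bar>overshoot J (x + 2 * t)\<bar> \<partial>\<mu>)" for x
  define G where "G x = (\<integral>t. growth J (x + 2 * t) \<partial>\<mu>)" for x
  have cont: "continuous_on UNIV u" "continuous_on UNIV (potential J)"
    "continuous_on UNIV (boundary_weight J)" "continuous_on UNIV (\<lambda>x::real. x\<^sup>2)"
    by (auto intro!: continuous_intros lipschitz_on_continuous_on[OF u]
        lipschitz_on_continuous_on[OF lipschitz_potential] simp: boundary_weight_def[abs_def])
  note intP = integrable_comp_ratio_map[OF J]
  have G: "G x = c + u x - P u x" for x
    using poisson[of x] by (simp add: G_def P_def)
  have RG: "R x \<le> G x" for x
    unfolding R_def G_def
    by (intro integral_mono integrable_abs_overshoot integrable_growth abs_overshoot_le_growth)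
  have GR: "G x \<le> R x + 2 * exp (- 2 * J)" for x
  proof -
    have "G x \<le> (\<integral>t. \<bar>overshoot J (x + 2 * t)\<bar> + 2 * exp (- 2 * J) \<partial>\<mu>)"
      unfolding G_def
      by (intro integral_mono integrable_growth growth_le_abs_overshoot Bochner_Integration.integrable_add
          integrable_abs_overshoot) auto
    then show ?thesis by (simp add: R_def integrable_abs_overshoot)
  qed
  have weight: "boundary_weight J x \<le> (P (potential J) x - potential J x + R x) / \<gamma>" if "\<bar>x\<bar> \<le> 2 * J" for x
    using boundary_weight_le[OF J that] \<gamma> by (simp add: P_def R_def \<gamma>_def field_simps)
  \<comment> \<open>With \<open>r\<close> the absolute overshoot and \<open>f\<close> the absolute
    image, split \<open>4 * J * r\<close> into \<open>2 * r * f\<close> and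
    \<open>2 * r * (2 * J - f)\<close>. The first part is at most the difference of squares;
    \<open>overshoot_times_gap_le\<close> bounds the second.\<close>
  have upper: "4 * J * R x \<le> x\<^sup>2 + 4 * second_moment - P (\<lambda>x. x\<^sup>2) x + 2 * R x + 8 * P (boundary_weight J) x" for x
  proof -
    have "4 * J * \<bar>overshoot J y\<bar> \<le> y\<^sup>2 - (ratio_map J y)\<^sup>2 + 2 * \<bar>overshoot J y\<bar> + 8 * boundary_weight J (ratio_map J y)" for y
      using overshoot_times_gap_le[OF J, of y] square_diff_ratio_map[OF J, of y]
      by (simp add: algebra_simps) (use zero_le_square[of "overshoot J y"] in linarith)
    then have "(\<integral>t. 4 * J * \<bar>overshoot J (x + 2 * t)\<bar> \<partial>\<mu>) \<le>
        (\<integral>t. (x + 2 * t)\<^sup>2 - (ratio_map J (x + 2 * t))\<^sup>2 + 2 * \<bar>overshoot J (x + 2 * t)\<bar>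
          + 8 * boundary_weight J (ratio_map J (x + 2 * t)) \<partial>\<mu>)"
      by (intro integral_mono Bochner_Integration.integrable_add Bochner_Integration.integrable_diff
          integrable_mult_right integrable_abs_overshoot integrable_shifted_square intP[OF cont(3)] intP[OF cont(4)])
    then show ?thesis
      by (simp add: integrable_abs_overshoot integrable_shifted_square intP[OF cont(3)] intP[OF cont(4)]
          integral_shifted_square P_def R_def)
  qed
  \<comment> \<open>The bound \<open>2 * J\<close> on the image gives the main term; the mean
    squared overshoot is left and is bounded by the boundary weight of the starting point.\<close>
  have lower: "x\<^sup>2 + 4 * second_moment - P (\<lambda>x. x\<^sup>2) x \<le> 4 * J * R x + 16 * K * boundary_weight J x" for x
  proof -
    have "y\<^sup>2 - (ratio_map J y)\<^sup>2 \<le> 4 * J * \<bar>overshoot J y\<bar> + (overshoot J y)\<^sup>2" for y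
      using square_diff_ratio_map[OF J, of y] mult_left_mono[OF abs_ratio_map_le[OF J, of y], of "\<bar>overshoot J y\<bar>"]
      by (simp add: algebra_simps power2_eq_square)
    then have "(\<integral>t. (x + 2 * t)\<^sup>2 - (ratio_map J (x + 2 * t))\<^sup>2 \<partial>\<mu>)
        \<le> (\<integral>t. 4 * J * \<bar>overshoot J (x + 2 * t)\<bar> + (overshoot J (x + 2 * t))\<^sup>2 \<partial>\<mu>)"
      by (intro integral_mono Bochner_Integration.integrable_add Bochner_Integration.integrable_diff
          integrable_mult_right integrable_abs_overshoot integrable_shifted_square integrable_overshoot_squared
          intP[OF cont(4)])
    then show ?thesis
      using integral_overshoot_squared_le[of J x]
      by (simp add: integrable_abs_overshoot integrable_shifted_square intP[OF cont(4)]
          integrable_overshoot_squared integral_shifted_square P_def R_def K_def)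
  qed
  show "4 * second_moment \<le> (4 * J + B) * c"
  proof -
    \<comment> \<open>The multiple \<open>B\<close> of the potential pays for the term
      \<open>16 * K * boundary_weight J x\<close>. This raises the coefficient of the mean overshoot
      to \<open>4 * J + B\<close>, hence also that of \<open>u\<close>.\<close>
    define W where "W x = x\<^sup>2 + B * potential J x - (4 * J + B) * u x" for x
    have PW: "P W x = P (\<lambda>x. x\<^sup>2) x + B * P (potential J) x - (4 * J + B) * P u x" for x
      unfolding P_def W_def
      by (simp add: intP[OF cont(1)] intP[OF cont(2)] intP[OF cont(4)])
    have "4 * second_moment - (4 * J + B) * c \<le> P W x - W x" if x: "\<bar>x\<bar> \<le> 2 * J" for x
    proof -
      have "16 * K * boundary_weight J x \<le> 16 * K * ((P (potential J) x - potential J x + R x) / \<gamma>)"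
        using K by (intro mult_left_mono weight x) auto
      also have "\<dots> = B * (P (potential J) x - potential J x + R x)" by (simp add: B)
      finally have "x\<^sup>2 + 4 * second_moment - P (\<lambda>x. x\<^sup>2) x
          \<le> (4 * J + B) * R x + B * (P (potential J) x - potential J x)"
        using lower[of x] by (simp add: algebra_simps)
      also have "(4 * J + B) * R x \<le> (4 * J + B) * G x"
        using J K \<gamma> by (intro mult_left_mono RG) (simp add: B)
      finally show ?thesis
        unfolding PW G W_def by (simp add: algebra_simps)
    qed
    then have "4 * second_moment - (4 * J + B) * c \<le> 0"
      unfolding P_def by (intro drift_nonpos[OF J, of W])
        (auto simp: W_def[abs_def] intro!: continuous_intros cont)
    then show ?thesis by simp
  qed
  show "(4 * J - A) * c \<le> 4 * second_moment + (4 * J - A) * (2 * exp (- 2 * J))" if AJ: "A \<le> 4 * J"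
  proof -
    \<comment> \<open>The term with \<open>boundary_weight\<close> carries the weight from the image
      back to the starting point, where \<open>weight\<close> applies. \<open>A\<close> collects the
      overshoot terms: 2 from \<open>upper\<close> and \<open>8 / \<gamma>\<close> from
      \<open>weight\<close>.\<close>
    define W where "W x = 8 / \<gamma> * potential J x + 8 * boundary_weight J x - x\<^sup>2 + (4 * J - A) * u x" for x
    have PW: "P W x = 8 / \<gamma> * P (potential J) x + 8 * P (boundary_weight J) x - P (\<lambda>x. x\<^sup>2) x + (4 * J - A) * P u x" for x
      unfolding P_def W_def
      by (simp add: intP[OF cont(1)] intP[OF cont(2)] intP[OF cont(3)] intP[OF cont(4)])
    have "(4 * J - A) * c - 4 * second_moment - (4 * J - A) * (2 * exp (- 2 * J)) \<le> P W x - W x"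
      if x: "\<bar>x\<bar> \<le> 2 * J" for x
    proof -
      have "8 * boundary_weight J x \<le> 8 / \<gamma> * (P (potential J) x - potential J x + R x)"
        using weight[OF x] \<gamma> by (simp add: field_simps)
      with upper[of x] have "(4 * J - A) * R x \<le> x\<^sup>2 + 4 * second_moment - P (\<lambda>x. x\<^sup>2) x
          + 8 * (P (boundary_weight J) x - boundary_weight J x) + 8 / \<gamma> * (P (potential J) x - potential J x)"
        unfolding A by (simp add: algebra_simps add_divide_distrib)
      moreover have "(4 * J - A) * G x \<le> (4 * J - A) * (R x + 2 * exp (- 2 * J))"
        using AJ by (intro mult_left_mono GR) simp
      ultimately show ?thesis
        unfolding PW G W_def by (simp add: algebra_simps)
    qed
    then have "(4 * J - A) * c - 4 * second_moment - (4 * J - A) * (2 * exp (- 2 * J)) \<le> 0"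
      unfolding P_def by (intro drift_nonpos[OF J, of W])
        (use \<gamma> in \<open>auto simp: W_def[abs_def] intro!: continuous_intros cont\<close>)
    then show ?thesis by simp
  qed
qed

end

section \<open>The transfer matrix\<close>

text \<open>The transfer matrix: the last spin is cut off and the remaining configurations are
  grouped by their spin \<open>c\<close> at site \<open>N\<close>.\<close>

lemma ising_Z_Suc:
  assumes b: "b \<in> {-1, 1}"
  shows "ising_Z (Suc N) h a b J =
    (\<Sum>c\<in>{-1, 1}. ising_Z N h a c J * exp (- 2 * J * of_bool (b \<noteq> c) + of_int b * h (Suc N)))"
proof -
  define w where "w N \<sigma> = exp (- 2 * J * (\<Sum>n=1..N. of_bool (\<sigma> n \<noteq> \<sigma> (n - 1)))
    + (\<Sum>n=1..N. of_int (\<sigma> n) * h n))" for N and \<sigma> :: "nat \<Rightarrow> int"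
  define S where "S = {\<sigma> \<in> {0..N} \<rightarrow>\<^sub>E {-1, 1 :: int}. \<sigma> 0 = a}"
  have fin: "finite S" unfolding S_def by (rule finite_subset[of _ "{0..N} \<rightarrow>\<^sub>E {-1, 1}"]) (auto intro: finite_PiE)
  have w_upd: "w (Suc N) (\<tau>(Suc N := b)) = w N \<tau> * exp (- 2 * J * of_bool (b \<noteq> \<tau> N) + of_int b * h (Suc N))" for \<tau>
  proof -
    have "(\<Sum>n=1..N. of_bool ((\<tau>(Suc N := b)) n \<noteq> (\<tau>(Suc N := b)) (n - 1)) :: real)
        = (\<Sum>n=1..N. of_bool (\<tau> n \<noteq> \<tau> (n - 1)))"
      by (intro sum.cong) auto
    moreover have "(\<Sum>n=1..N. of_int ((\<tau>(Suc N := b)) n) * h n) = (\<Sum>n=1..N. of_int (\<tau> n) * h n)"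
      by (intro sum.cong) auto
    ultimately show ?thesis
      by (simp add: w_def distrib_left flip: exp_add)
  qed
  have "ising_Z (Suc N) h a b J
      = (\<Sum>\<sigma> \<in> {\<sigma> \<in> {0..Suc N} \<rightarrow>\<^sub>E {-1, 1 :: int}. \<sigma> 0 = a \<and> \<sigma> (Suc N) = b}. w (Suc N) \<sigma>)"
    by (simp add: ising_Z_def w_def)
  also have "\<dots> = (\<Sum>\<tau>\<in>S. w (Suc N) (\<tau>(Suc N := b)))"
  \<comment> \<open>Elements of \<open>PiE\<close> are fixed outside their domain, so restricting to
    \<open>{0..N}\<close> and putting the spin \<open>b\<close> back recovers the
    configuration.\<close>
  proof (rule sum.reindex_bij_witness[where i = "\<lambda>\<tau>. \<tau>(Suc N := b)" and j = "\<lambda>\<sigma>. restrict \<sigma> {0..N}"])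
    fix \<sigma> assume *: "\<sigma> \<in> {\<sigma> \<in> {0..Suc N} \<rightarrow>\<^sub>E {-1, 1 :: int}. \<sigma> 0 = a \<and> \<sigma> (Suc N) = b}"
    show eq: "(restrict \<sigma> {0..N})(Suc N := b) = \<sigma>"
    proof
      fix n
      show "((restrict \<sigma> {0..N})(Suc N := b)) n = \<sigma> n"
        using * PiE_arb[of \<sigma> "{0..Suc N}" "\<lambda>_. {-1, 1}" n] by (cases "n \<le> N") auto
    qed
    show "restrict \<sigma> {0..N} \<in> S" using * by (auto simp: S_def PiE_iff)
    show "w (Suc N) ((restrict \<sigma> {0..N})(Suc N := b)) = w (Suc N) \<sigma>" by (simp add: eq)
  next
    fix \<tau> assume *: "\<tau> \<in> S"
    show "restrict (\<tau>(Suc N := b)) {0..N} = \<tau>"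
    proof
      fix n
      show "restrict (\<tau>(Suc N := b)) {0..N} n = \<tau> n"
        using * PiE_arb[of \<tau> "{0..N}" "\<lambda>_. {-1, 1}" n] by (cases "n \<le> N") (auto simp: S_def)
    qed
    show "\<tau>(Suc N := b) \<in> {\<sigma> \<in> {0..Suc N} \<rightarrow>\<^sub>E {-1, 1 :: int}. \<sigma> 0 = a \<and> \<sigma> (Suc N) = b}"
      using * b by (auto simp: S_def PiE_iff extensional_def)
  qed
  also have "\<dots> = (\<Sum>c\<in>{-1, 1}. \<Sum>\<tau> \<in> {\<tau> \<in> S. \<tau> N = c}. w (Suc N) (\<tau>(Suc N := b)))"
    by (rule sum.group[symmetric, OF fin]) (auto simp: S_def PiE_iff)
  also have "\<dots> = (\<Sum>c\<in>{-1, 1}. ising_Z N h a c J * exp (- 2 * J * of_bool (b \<noteq> c) + of_int b * h (Suc N)))"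
  proof (rule sum.cong[OF refl])
    fix c :: int
    have "(\<Sum>\<tau> \<in> {\<tau> \<in> S. \<tau> N = c}. w (Suc N) (\<tau>(Suc N := b)))
        = (\<Sum>\<tau> \<in> {\<tau> \<in> S. \<tau> N = c}. w N \<tau> * exp (- 2 * J * of_bool (b \<noteq> c) + of_int b * h (Suc N)))"
      by (intro sum.cong) (auto simp: w_upd)
    also have "\<dots> = ising_Z N h a c J * exp (- 2 * J * of_bool (b \<noteq> c) + of_int b * h (Suc N))"
      by (simp add: sum_distrib_right[symmetric] ising_Z_def S_def w_def conj_assoc)
    finally show "(\<Sum>\<tau> \<in> {\<tau> \<in> S. \<tau> N = c}. w (Suc N) (\<tau>(Suc N := b)))
        = ising_Z N h a c J * exp (- 2 * J * of_bool (b \<noteq> c) + of_int b * h (Suc N))" .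
  qed
  finally show ?thesis .
qed

lemma ising_Z_0: "a \<in> {-1, 1} \<Longrightarrow> ising_Z 0 h a b J = of_bool (a = b)"
proof -
  assume a: "a \<in> {-1, 1}"
  have "{\<sigma> \<in> {0..0} \<rightarrow>\<^sub>E {-1, 1 :: int}. \<sigma> (0::nat) = a \<and> \<sigma> 0 = b} = (if a = b then {\<lambda>x\<in>{0}. a} else {})"
  proof -
    have "\<sigma> = (\<lambda>x\<in>{0}. a)" if "\<sigma> \<in> {0..0} \<rightarrow>\<^sub>E {-1, 1 :: int}" "\<sigma> (0::nat) = a" for \<sigma>
      using that by (intro ext) (auto simp: PiE_iff extensional_def)
    then show ?thesis using a by (auto simp: PiE_iff)
  qed
  then show ?thesis by (simp add: ising_Z_def)
qed

text \<open>The state is recorded after \<open>ratio_map\<close> and before the next field is added,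
  which keeps it in a bounded interval. The log-ratio at \<open>N + 1\<close> is the state
  \<open>N\<close> plus \<open>2 * h (N + 1)\<close>.\<close>

primrec ratio_chain :: "real \<Rightarrow> (nat \<Rightarrow> real) \<Rightarrow> real \<Rightarrow> nat \<Rightarrow> real" where
  "ratio_chain J h x 0 = x"
| "ratio_chain J h x (Suc n) = ratio_map J (ratio_chain J h x n + 2 * h (Suc n))"

lemma ratio_chain_fun_upd: "n < i \<Longrightarrow> ratio_chain J (h(i := y)) x n = ratio_chain J h x n"
  by (induction n) auto

lemma abs_ratio_chain_le: "0 \<le> J \<Longrightarrow> \<bar>x\<bar> \<le> 2 * J \<Longrightarrow> \<bar>ratio_chain J h x n\<bar> \<le> 2 * J"
  by (cases n) (auto simp: abs_ratio_map_le)

text \<open>For the starting points used below, this plus \<open>- 2 * J\<close> is the logarithm of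
  the product of the two partition functions at \<open>N + 1\<close>.\<close>

definition total_growth :: "real \<Rightarrow> (nat \<Rightarrow> real) \<Rightarrow> real \<Rightarrow> nat \<Rightarrow> real" where
  "total_growth J h x N = (\<Sum>k<N. growth J (ratio_chain J h x k + 2 * h (Suc k)))"

lemma mono_total_growth: "mono (total_growth J h x)"
  unfolding total_growth_def by (intro monoI sum_mono2) (auto simp: growth_nonneg)

text \<open>The starting points \<open>\<plusminus> 2 * J\<close> are the images of \<open>\<plusminus> \<infinity>\<close> under the ratio map: at \<open>N = 0\<close> one of the two
  partition functions vanishes.\<close>

lemma ising_Z_eq_exp:
  assumes a: "a \<in> {-1, 1}" and b: "b \<in> {-1, 1}"
  shows "ising_Z (Suc N) h a b J = exp ((- 2 * J + total_growth J h (2 * J * of_int a) N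
    + of_int b * (ratio_chain J h (2 * J * of_int a) N + 2 * h (Suc N))) / 2)"
  using b
proof (induction N arbitrary: b)
  case 0
  then show ?case
    using a by (subst ising_Z_Suc) (auto simp: ising_Z_0 total_growth_def algebra_simps diff_divide_distrib)
next
  case (Suc N)
  define T l t where "T = total_growth J h (2 * J * of_int a) N"
    and "l = ratio_chain J h (2 * J * of_int a) N + 2 * h (Suc N)" and "t = h (Suc (Suc N))"
  \<comment> \<open>Half the sum and half the difference of \<open>growth\<close> and
    \<open>ratio_map\<close> keep one \<open>softplus\<close> each: the logarithm of the factor
    obtained by adding the two transfer matrix terms.\<close>
  have plus: "(growth J l + ratio_map J l) / 2 = l / 2 + softplus (- l - 2 * J)"
    and minus: "(growth J l - ratio_map J l) / 2 = - l / 2 + softplus (l - 2 * J)"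
    by (simp_all add: growth_def ratio_map_def overshoot_def field_simps)
  have IH: "ising_Z (Suc N) h a 1 J = exp ((- 2 * J + T + l) / 2)"
    "ising_Z (Suc N) h a (- 1) J = exp ((- 2 * J + T - l) / 2)"
    using Suc.IH[of 1] Suc.IH[of "-1"] by (simp_all add: T_def l_def)
  have step: "total_growth J h (2 * J * of_int a) (Suc N) = T + growth J l"
    "ratio_chain J h (2 * J * of_int a) (Suc N) = ratio_map J l"
    by (simp_all add: total_growth_def T_def l_def)
  from Suc.prems consider "b = 1" | "b = -1" by auto
  then show ?case
  proof cases
    case 1
    have "ising_Z (Suc (Suc N)) h a b J
        = exp ((- 2 * J + T + l) / 2 + t) + exp ((- 2 * J + T - l) / 2 - 2 * J + t)"
      unfolding 1 by (subst ising_Z_Suc) (auto simp: IH t_def simp flip: exp_add)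
    also have "\<dots> = exp ((- 2 * J + T) / 2 + l / 2 + t) * exp (softplus (- l - 2 * J))"
      by (simp add: exp_softplus distrib_left add_divide_distrib diff_divide_distrib algebra_simps flip: exp_add)
    also have "\<dots> = exp ((- 2 * J + T) / 2 + (growth J l + ratio_map J l) / 2 + t)"
      unfolding plus by (simp add: algebra_simps flip: exp_add)
    finally show ?thesis
      unfolding step 1 t_def by (simp add: field_simps)
  next
    case 2
    have "ising_Z (Suc (Suc N)) h a b J
        = exp ((- 2 * J + T + l) / 2 - 2 * J - t) + exp ((- 2 * J + T - l) / 2 - t)"
      unfolding 2 by (subst ising_Z_Suc) (auto simp: IH t_def simp flip: exp_add)
    also have "\<dots> = exp ((- 2 * J + T) / 2 - l / 2 - t) * exp (softplus (l - 2 * J))"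
      by (simp add: exp_softplus distrib_left add_divide_distrib diff_divide_distrib algebra_simps flip: exp_add)
    also have "\<dots> = exp ((- 2 * J + T) / 2 + (growth J l - ratio_map J l) / 2 - t)"
      unfolding minus by (simp add: algebra_simps flip: exp_add)
    finally show ?thesis
      unfolding step 2 t_def by (simp add: field_simps)
  qed
qed

section \<open>A law of large numbers\<close>

text \<open>Between consecutive squares \<open>k\<^sup>2\<close> and \<open>(Suc k)\<^sup>2\<close>
  monotonicity sandwiches the average, up to factors \<open>(k / Suc k)\<^sup>2\<close> and their
  inverses, which tend to 1.\<close>

lemma tendsto_along_squares_imp_tendsto:
  fixes S :: "nat \<Rightarrow> real"
  assumes mono: "mono S" and nonneg: "\<And>n. 0 \<le> S n"
    and lim: "(\<lambda>n. S (n\<^sup>2) / real (n\<^sup>2)) \<longlonglongrightarrow> c"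
  shows "(\<lambda>N. S N / real N) \<longlonglongrightarrow> c"
proof -
  have "filterlim floor_sqrt at_top sequentially"
    unfolding filterlim_at_top
  proof
    fix Z
    show "\<forall>\<^sub>F n in sequentially. Z \<le> floor_sqrt n"
      using eventually_ge_at_top[of "Z\<^sup>2"] by eventually_elim (rule le_floor_sqrtI)
  qed
  moreover have "(\<lambda>k. S (k\<^sup>2) / real (k\<^sup>2) * (real k / real (Suc k))\<^sup>2) \<longlonglongrightarrow> c * 1"
    by (rule tendsto_mult[OF lim]) real_asymp
  moreover have "(\<lambda>k. S ((Suc k)\<^sup>2) / real ((Suc k)\<^sup>2) * (real (Suc k) / real k)\<^sup>2) \<longlonglongrightarrow> c * 1"
    by (rule tendsto_mult[OF LIMSEQ_Suc[OF lim]]) real_asymp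
  ultimately have lims: "(\<lambda>N. S ((floor_sqrt N)\<^sup>2) / real ((floor_sqrt N)\<^sup>2) * (real (floor_sqrt N) / real (Suc (floor_sqrt N)))\<^sup>2) \<longlonglongrightarrow> c * 1"
    "(\<lambda>N. S ((Suc (floor_sqrt N))\<^sup>2) / real ((Suc (floor_sqrt N))\<^sup>2) * (real (Suc (floor_sqrt N)) / real (floor_sqrt N))\<^sup>2) \<longlonglongrightarrow> c * 1"
    using filterlim_compose by blast+
  have "(\<lambda>N. S N / real N) \<longlonglongrightarrow> c * 1"
  proof (rule tendsto_sandwich[OF _ _ lims])
    have *: "S ((floor_sqrt N)\<^sup>2) / real ((floor_sqrt N)\<^sup>2) * (real (floor_sqrt N) / real (Suc (floor_sqrt N)))\<^sup>2 \<le> S N / real N \<and>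
      S N / real N \<le> S ((Suc (floor_sqrt N))\<^sup>2) / real ((Suc (floor_sqrt N))\<^sup>2) * (real (Suc (floor_sqrt N)) / real (floor_sqrt N))\<^sup>2"
      if "0 < N" for N
    proof -
      define k where "k = floor_sqrt N"
      have k: "0 < k" "k\<^sup>2 \<le> N" "N \<le> (Suc k)\<^sup>2"
        using that Suc_floor_sqrt_power2_gt[of N] by (simp_all add: k_def less_imp_le)
      have kN: "(real k)\<^sup>2 \<le> real N" "real N \<le> (real (Suc k))\<^sup>2"
        using k(2,3) by (metis of_nat_le_iff of_nat_power)+
      have "S (k\<^sup>2) / real (k\<^sup>2) * (real k / real (Suc k))\<^sup>2 = S (k\<^sup>2) / (real (Suc k))\<^sup>2"
        using k by (simp add: power_divide)
      also have "\<dots> \<le> S N / real N"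
        using monoD[OF mono k(2)] kN nonneg that by (intro frac_le) auto
      finally have 1: "S (k\<^sup>2) / real (k\<^sup>2) * (real k / real (Suc k))\<^sup>2 \<le> S N / real N" .
      have "S N / real N \<le> S ((Suc k)\<^sup>2) / (real k)\<^sup>2"
        using monoD[OF mono k(3)] kN nonneg k by (intro frac_le) auto
      also have "\<dots> = S ((Suc k)\<^sup>2) / real ((Suc k)\<^sup>2) * (real (Suc k) / real k)\<^sup>2"
        by (simp add: power_divide)
      finally show ?thesis using 1 unfolding k_def by blast
    qed
    show "\<forall>\<^sub>F N in sequentially. S ((floor_sqrt N)\<^sup>2) / real ((floor_sqrt N)\<^sup>2) * (real (floor_sqrt N) / real (Suc (floor_sqrt N)))\<^sup>2 \<le> S N / real N"
      using eventually_gt_at_top[of 0] by eventually_elim (use * in blast)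
    show "\<forall>\<^sub>F N in sequentially. S N / real N \<le> S ((Suc (floor_sqrt N))\<^sup>2) / real ((Suc (floor_sqrt N))\<^sup>2) * (real (Suc (floor_sqrt N)) / real (floor_sqrt N))\<^sup>2"
      using eventually_gt_at_top[of 0] by eventually_elim (use * in blast)
  qed
  then show ?thesis by simp
qed

text \<open>The sum of all the squares has finite mean, so it is finite almost surely and its terms
  tend to 0.\<close>

lemma AE_tendsto_0_if_summable_second_moments:
  fixes X :: "nat \<Rightarrow> 'a \<Rightarrow> real"
  assumes int: "\<And>n. integrable M (\<lambda>x. (X n x)\<^sup>2)"
    and bound: "\<And>n. (\<integral>x. (X n x)\<^sup>2 \<partial>M) \<le> B n" and summ: "summable B"
  shows "AE x in M. (\<lambda>n. X n x) \<longlonglongrightarrow> 0"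
proof -
  have [measurable]: "(\<lambda>x. (X n x)\<^sup>2) \<in> borel_measurable M" for n
    using int by (rule borel_measurable_integrable)
  have nonneg: "0 \<le> (\<integral>x. (X n x)\<^sup>2 \<partial>M)" for n by (intro integral_nonneg_AE) auto
  have "summable (\<lambda>n. \<integral>x. (X n x)\<^sup>2 \<partial>M)"
    using bound nonneg by (intro summable_comparison_test[OF _ summ]) auto
  then have "(\<Sum>n. ennreal (\<integral>x. (X n x)\<^sup>2 \<partial>M)) \<noteq> \<infinity>"
    using suminf_ennreal2[OF nonneg] by simp
  moreover have "(\<integral>\<^sup>+x. (\<Sum>n. ennreal ((X n x)\<^sup>2)) \<partial>M) = (\<Sum>n. ennreal (\<integral>x. (X n x)\<^sup>2 \<partial>M))"
    by (subst nn_integral_suminf) (auto simp: nn_integral_eq_integral[OF int])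
  ultimately have "AE x in M. (\<Sum>n. ennreal ((X n x)\<^sup>2)) \<noteq> \<infinity>"
    by (intro nn_integral_PInf_AE) auto
  then show ?thesis
  proof eventually_elim
    case (elim x)
    then have "summable (\<lambda>n. (X n x)\<^sup>2)" by (intro summable_suminf_not_top) auto
    then have "(\<lambda>n. (X n x)\<^sup>2) \<longlonglongrightarrow> 0" by (rule summable_LIMSEQ_zero)
    then have "(\<lambda>n. sqrt ((X n x)\<^sup>2)) \<longlonglongrightarrow> sqrt 0" by (rule tendsto_real_sqrt)
    then show ?case by (simp add: tendsto_rabs_zero_iff)
  qed
qed

lemma integrable_mult_if_squares_integrable:
  fixes f g :: "'a \<Rightarrow> real"
  assumes [measurable]: "f \<in> borel_measurable M" "g \<in> borel_measurable M"
    and "integrable M (\<lambda>x. (f x)\<^sup>2)" "integrable M (\<lambda>x. (g x)\<^sup>2)"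
  shows "integrable M (\<lambda>x. f x * g x)"
proof (rule Bochner_Integration.integrable_bound[of _ "\<lambda>x. (f x)\<^sup>2 + (g x)\<^sup>2"])
  have "\<bar>f x * g x\<bar> \<le> (f x)\<^sup>2 + (g x)\<^sup>2" for x
    using sum_squares_bound[of "\<bar>f x\<bar>" "\<bar>g x\<bar>"] mult_nonneg_nonneg[OF abs_ge_zero abs_ge_zero, of "f x" "g x"]
    unfolding abs_mult power2_abs by linarith
  then show "AE x in M. norm (f x * g x) \<le> norm ((f x)\<^sup>2 + (g x)\<^sup>2)" by simp
qed (use assms in auto)

text \<open>Orthogonality bounds the second moment of the sum of \<open>N\<close> terms by
  \<open>C * N\<close>, that of the average by \<open>C / N\<close>. Along squares these bounds are
  summable.\<close>

lemma AE_orthogonal_averages_along_squares: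
  fixes D :: "nat \<Rightarrow> 'a \<Rightarrow> real"
  assumes meas [measurable]: "\<And>n. D n \<in> borel_measurable M"
    and int: "\<And>n. integrable M (\<lambda>x. (D n x)\<^sup>2)"
    and bound: "\<And>n. (\<integral>x. (D n x)\<^sup>2 \<partial>M) \<le> C"
    and orth: "\<And>m n. m < n \<Longrightarrow> (\<integral>x. D m x * D n x \<partial>M) = 0"
  shows "AE x in M. (\<lambda>n. (\<Sum>k<n\<^sup>2. D k x) / real (n\<^sup>2)) \<longlonglongrightarrow> 0"
proof -
  have sums: "integrable M (\<lambda>x. (\<Sum>k<N. D k x)\<^sup>2) \<and> (\<integral>x. (\<Sum>k<N. D k x)\<^sup>2 \<partial>M) \<le> C * real N" for N
  proof (induction N)
    case (Suc N)
    have mult: "integrable M (\<lambda>x. D k x * D N x)" for k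
      by (intro integrable_mult_if_squares_integrable int) auto
    have cross: "integrable M (\<lambda>x. 2 * (\<Sum>k<N. D k x * D N x))"
      using mult by simp
    have eq: "(\<Sum>k<Suc N. D k x)\<^sup>2 = (\<Sum>k<N. D k x)\<^sup>2 + (D N x)\<^sup>2 + 2 * (\<Sum>k<N. D k x * D N x)" for x
      by (simp add: power2_sum sum_distrib_right)
    have "(\<integral>x. 2 * (\<Sum>k<N. D k x * D N x) \<partial>M) = 0"
      using mult by (simp add: orth)
    then show ?case
      unfolding eq using Suc int[of N] bound[of N] cross
      by (simp add: algebra_simps)
  qed simp
  show ?thesis
  proof (rule AE_tendsto_0_if_summable_second_moments)
    fix n :: nat
    show "integrable M (\<lambda>x. ((\<Sum>k<n\<^sup>2. D k x) / real (n\<^sup>2))\<^sup>2)"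
      using sums[of "n\<^sup>2"] by (simp add: power_divide)
    have "(\<integral>x. ((\<Sum>k<n\<^sup>2. D k x) / real (n\<^sup>2))\<^sup>2 \<partial>M) \<le> C * real (n\<^sup>2) / (real (n\<^sup>2))\<^sup>2"
      using sums[of "n\<^sup>2"] by (simp add: power_divide divide_right_mono)
    also have "\<dots> = C * inverse (real n ^ 2)"
      by (simp add: power2_eq_square field_simps)
    finally show "(\<integral>x. ((\<Sum>k<n\<^sup>2. D k x) / real (n\<^sup>2))\<^sup>2 \<partial>M) \<le> C * inverse (real n ^ 2)" .
  qed (intro summable_mult inverse_power_summable order_refl)
qed

text \<open>Fubini with coordinate \<open>i\<close> integrated first. This takes the place of
  conditional expectations: a martingale increment only has to be integrated over its newest noise
  variable.\<close>

lemma integral_PiM_eq_0_if_coordinate_integral_eq_0: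
  fixes F :: "('i \<Rightarrow> 'a) \<Rightarrow> real"
  assumes M: "\<And>i. prob_space (M i)" and i: "i \<in> I"
    and int: "integrable (PiM I M) F"
    and zero: "\<And>X. (\<integral>x. F (X(i := x)) \<partial>M i) = 0"
  shows "(\<integral>X. F X \<partial>PiM I M) = 0"
proof -
  define R where "R = PiM (I - {i}) M"
  interpret R: prob_space R unfolding R_def by (rule prob_space_PiM) (rule M)
  interpret Mi: prob_space "M i" by (rule M)
  interpret pair_sigma_finite "M i" R ..
  have I: "insert i (I - {i}) = I" using i by auto
  have distr: "PiM I M = distr (M i \<Otimes>\<^sub>M R) (PiM I M) (\<lambda>(x, X). X(i := x))"
    using distr_pair_PiM_eq_PiM[of "I - {i}" M i] M unfolding R_def I by simp
  have meas: "(\<lambda>(x, X). X(i := x)) \<in> measurable (M i \<Otimes>\<^sub>M R) (PiM I M)"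
    using measurable_add_dim[of i "I - {i}" M] unfolding R_def I
    by (subst measurable_pair_swap_iff) (simp add: case_prod_unfold)
  have "integrable (distr (M i \<Otimes>\<^sub>M R) (PiM I M) (\<lambda>(x, X). X(i := x))) F"
    using int by (subst distr[symmetric])
  then have int': "integrable (M i \<Otimes>\<^sub>M R) (\<lambda>(x, X). F (X(i := x)))"
    using meas borel_measurable_integrable[OF int] by (subst (asm) integrable_distr_eq) (auto simp: case_prod_unfold)
  have "(\<integral>X. F X \<partial>PiM I M) = (\<integral>X. F X \<partial>distr (M i \<Otimes>\<^sub>M R) (PiM I M) (\<lambda>(x, X). X(i := x)))"
    by (subst distr) simp
  also have "\<dots> = integral\<^sup>L (M i \<Otimes>\<^sub>M R) (\<lambda>(x, X). F (X(i := x)))"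
    using meas borel_measurable_integrable[OF int] by (subst integral_distr) (auto simp: case_prod_unfold)
  also have "\<dots> = (\<integral>X. (\<integral>x. F (X(i := x)) \<partial>M i) \<partial>R)"
    by (rule integral_snd[OF int', symmetric])
  finally show ?thesis by (simp add: zero)
qed

section \<open>Existence of the free energy\<close>

context symmetric_noise
begin

section \<open>The product space of noise sequences and the almost sure growth rate\<close>

definition noise_sequences :: "(nat \<Rightarrow> real) measure" where
  "noise_sequences = (\<Pi>\<^sub>M n\<in>{1::nat..}. \<mu>)"

lemma prob_space_noise_sequences: "prob_space noise_sequences"
  unfolding noise_sequences_def by (rule prob_space_PiM) (rule prob_space_axioms)

lemma noise_component_measurable: "(\<lambda>h. h (Suc n)) \<in> measurable noise_sequences \<mu>"
  unfolding noise_sequences_def by (rule measurable_component_singleton) simp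

lemma noise_component_borel_measurable [measurable]: "(\<lambda>h. h (Suc n)) \<in> borel_measurable noise_sequences"
  using noise_component_measurable by (simp cong: measurable_cong_sets add: sets_eq)

lemma distr_noise_component: "distr noise_sequences \<mu> (\<lambda>h. h (Suc n)) = \<mu>"
  unfolding noise_sequences_def by (rule distr_PiM_component) (simp_all add: prob_space_axioms)

lemma integrable_noise_component:
  assumes [measurable]: "integrable \<mu> (\<phi> :: real \<Rightarrow> real)"
  shows "integrable noise_sequences (\<lambda>h. \<phi> (h (Suc n)))"
    and "(\<integral>h. \<phi> (h (Suc n)) \<partial>noise_sequences) = (\<integral>t. \<phi> t \<partial>\<mu>)"
proof -
  show "integrable noise_sequences (\<lambda>h. \<phi> (h (Suc n)))"
    using integrable_distr[OF noise_component_measurable[of n], of \<phi>] assms by (simp add: distr_noise_component)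
  show "(\<integral>h. \<phi> (h (Suc n)) \<partial>noise_sequences) = (\<integral>t. \<phi> t \<partial>\<mu>)"
    using integral_distr[OF noise_component_measurable[of n], of \<phi>] borel_measurable_integrable[OF assms] by (simp add: distr_noise_component)
qed

lemma AE_noise_sublinear: "AE h in noise_sequences. (\<lambda>n. h (Suc n) / real (Suc n)) \<longlonglongrightarrow> 0"
proof (rule AE_tendsto_0_if_summable_second_moments)
  fix n
  show "integrable noise_sequences (\<lambda>h. (h (Suc n) / real (Suc n))\<^sup>2)"
    using integrable_noise_component(1)[OF integrable_square, of n] by (simp add: power_divide)
  show "(\<integral>h. (h (Suc n) / real (Suc n))\<^sup>2 \<partial>noise_sequences) \<le> second_moment * inverse (real (Suc n) ^ 2)"
    using integrable_noise_component(2)[OF integrable_square, of n]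
    by (simp add: power_divide second_moment_def inverse_eq_divide)
next
  show "summable (\<lambda>n. second_moment * inverse (real (Suc n) ^ 2))"
    using inverse_power_summable[of 2, where 'a = real]
    by (intro summable_mult) (simp only: summable_Suc_iff[of "\<lambda>n. inverse (real n ^ 2)"] order_refl)
qed

lemma ratio_chain_measurable [measurable]:
  "0 \<le> J \<Longrightarrow> (\<lambda>h. ratio_chain J h x n) \<in> borel_measurable noise_sequences"
proof (induction n)
  case (Suc n)
  note [measurable] = Suc.IH[OF Suc.prems] ratio_map_measurable[OF Suc.prems]
  show ?case by (simp add: noise_component_borel_measurable)
qed simp

text \<open>By the Poisson equation the increments \<open>D k\<close> below are martingale differences.\<close>

lemma AE_total_growth:
  assumes J: "0 \<le> J" and x: "\<bar>x\<bar> \<le> 2 * J"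
    and u: "L-lipschitz_on UNIV u"
    and poisson: "\<And>x. (\<integral>t. growth J (x + 2 * t) \<partial>\<mu>) + (\<integral>t. u (ratio_map J (x + 2 * t)) \<partial>\<mu>) = u x + c"
  shows "AE h in noise_sequences. (\<lambda>N. total_growth J h x N / real N) \<longlonglongrightarrow> c"
proof -
  interpret H: prob_space noise_sequences by (rule prob_space_noise_sequences)
  define m where "m h n = ratio_chain J h x n" for h n
  define D where "D k h = growth J (m h k + 2 * h (Suc k)) + u (m h (Suc k)) - u (m h k) - c" for k h
  define B where "B = growth J 0 + 4 * J + L * (4 * J) + \<bar>c\<bar>"
  have m_le: "\<bar>m h k\<bar> \<le> 2 * J" for h k
    unfolding m_def by (rule abs_ratio_chain_le[OF J x])
  have [measurable]: "u \<in> borel_measurable borel" "growth J \<in> borel_measurable borel"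
    by (rule lipschitz_imp_borel_measurable[OF u] lipschitz_imp_borel_measurable[OF lipschitz_growth])+
  have [measurable]: "(\<lambda>h. m h k) \<in> borel_measurable noise_sequences" for k
    unfolding m_def using J by measurable
  have meas [measurable]: "D k \<in> borel_measurable noise_sequences" for k
    unfolding D_def by measurable
  have L: "0 \<le> L" by (rule lipschitz_on_nonneg[OF u])
  have B: "0 \<le> B" using J L growth_nonneg[of J 0] by (simp add: B_def)
  have D_bound: "\<bar>D k h\<bar> \<le> B + 4 * \<bar>h (Suc k)\<bar>" for k h
  proof -
    have "\<bar>growth J (m h k + 2 * h (Suc k))\<bar> \<le> growth J 0 + 2 * \<bar>m h k + 2 * h (Suc k)\<bar>"
      using lipschitz_onD[OF lipschitz_growth, of "m h k + 2 * h (Suc k)" 0 J] growth_nonneg[of J 0]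
      by (simp add: dist_real_def)
    moreover have "\<bar>u (m h (Suc k)) - u (m h k)\<bar> \<le> L * (4 * J)"
    proof -
      have "\<bar>u (m h (Suc k)) - u (m h k)\<bar> \<le> L * \<bar>m h (Suc k) - m h k\<bar>"
        using lipschitz_onD[OF u, of "m h (Suc k)" "m h k"] by (simp add: dist_real_def)
      also have "\<dots> \<le> L * (4 * J)"
        using m_le[of h "Suc k"] m_le[of h k] L by (intro mult_left_mono) auto
      finally show ?thesis .
    qed
    moreover have "\<bar>m h k + 2 * h (Suc k)\<bar> \<le> 2 * J + 2 * \<bar>h (Suc k)\<bar>"
      using m_le[of h k] by linarith
    moreover have "\<bar>D k h\<bar> \<le> \<bar>growth J (m h k + 2 * h (Suc k))\<bar> + \<bar>u (m h (Suc k)) - u (m h k)\<bar> + \<bar>c\<bar>"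
      unfolding D_def by linarith
    ultimately show ?thesis unfolding B_def by linarith
  qed
  have D_sq: "(D k h)\<^sup>2 \<le> 2 * B\<^sup>2 + 32 * (h (Suc k))\<^sup>2" for k h
  proof -
    have "(D k h)\<^sup>2 \<le> (B + 4 * \<bar>h (Suc k)\<bar>)\<^sup>2"
      using power_mono[OF D_bound abs_ge_zero, of k h 2] by simp
    also have "\<dots> \<le> 2 * B\<^sup>2 + 32 * (h (Suc k))\<^sup>2"
      using sum_squares_bound[of B "4 * \<bar>h (Suc k)\<bar>"]
      by (simp add: power2_sum power_mult_distrib)
    finally show ?thesis .
  qed
  have sq_int: "integrable noise_sequences (\<lambda>h. 2 * B\<^sup>2 + 32 * (h (Suc k))\<^sup>2)" for k
    using integrable_noise_component(1)[OF integrable_square, of k] by simp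
  have D_int: "integrable noise_sequences (\<lambda>h. (D k h)\<^sup>2)" for k
    by (rule Bochner_Integration.integrable_bound[OF sq_int]) (use D_sq in auto)
  have D_var: "(\<integral>h. (D k h)\<^sup>2 \<partial>noise_sequences) \<le> 2 * B\<^sup>2 + 32 * second_moment" for k
  proof -
    have "(\<integral>h. (D k h)\<^sup>2 \<partial>noise_sequences) \<le> (\<integral>h. 2 * B\<^sup>2 + 32 * (h (Suc k))\<^sup>2 \<partial>noise_sequences)"
      by (rule integral_mono[OF D_int sq_int D_sq])
    also have "\<dots> = 2 * B\<^sup>2 + 32 * second_moment"
      using integrable_noise_component[OF integrable_square, of k] H.prob_space
      by (simp add: second_moment_def)
    finally show ?thesis .
  qed
  \<comment> \<open>For \<open>j < k\<close> the increment \<open>D j\<close> does not involve the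
    coordinate \<open>Suc k\<close>, while integrating \<open>D k\<close> over that coordinate gives
    0 by the Poisson equation.\<close>
  have orth: "(\<integral>h. D j h * D k h \<partial>noise_sequences) = 0" if "j < k" for j k
    unfolding noise_sequences_def
  proof (rule integral_PiM_eq_0_if_coordinate_integral_eq_0[where i = "Suc k"])
    show "integrable (\<Pi>\<^sub>M n\<in>{1::nat..}. \<mu>) (\<lambda>h. D j h * D k h)"
      unfolding noise_sequences_def[symmetric]
      by (rule integrable_mult_if_squares_integrable[OF meas meas D_int D_int])
    fix h :: "nat \<Rightarrow> real"
    have m_upd: "m (h(Suc k := t)) n = m h n" if "n \<le> k" for n t
      unfolding m_def by (rule ratio_chain_fun_upd) (use that in simp)
    have Dj: "D j (h(Suc k := t)) = D j h" for t
      using that by (simp add: D_def m_upd)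
    have Dk: "D k (h(Suc k := t)) = growth J (m h k + 2 * t) + u (ratio_map J (m h k + 2 * t)) - (u (m h k) + c)" for t
    proof -
      have "m (h(Suc k := t)) (Suc k) = ratio_map J (m (h(Suc k := t)) k + 2 * t)"
        by (simp add: m_def)
      then show ?thesis by (simp add: D_def m_upd)
    qed
    have int_u: "integrable \<mu> (\<lambda>t. u (ratio_map J (m h k + 2 * t)))"
      by (rule integrable_comp_ratio_map[OF J lipschitz_on_continuous_on[OF u]])
    show "(\<integral>t. D j (h(Suc k := t)) * D k (h(Suc k := t)) \<partial>\<mu>) = 0"
      unfolding Dj Dk using poisson[of "m h k"] by (simp add: int_u integrable_growth)
  qed (simp_all add: prob_space_axioms)
  have "AE h in noise_sequences. (\<lambda>n. (\<Sum>k<n\<^sup>2. D k h) / real (n\<^sup>2)) \<longlonglongrightarrow> 0"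
    by (rule AE_orthogonal_averages_along_squares[OF meas D_int D_var orth])
  then show ?thesis
  proof eventually_elim
    case (elim h)
    \<comment> \<open>The differences of \<open>u\<close> telescope to a bounded quantity, which
      disappears after division by \<open>N\<close>.\<close>
    have sum_D: "(\<Sum>k<N. D k h) = total_growth J h x N + (u (m h N) - u x) - real N * c" for N
      by (induction N) (simp_all add: total_growth_def D_def m_def algebra_simps)
    have u_bound: "\<bar>u (m h N) - u x\<bar> \<le> L * (4 * J)" for N
    proof -
      have "\<bar>u (m h N) - u x\<bar> \<le> L * \<bar>m h N - x\<bar>"
        using lipschitz_onD[OF u, of "m h N" x] by (simp add: dist_real_def)
      also have "\<dots> \<le> L * (4 * J)"
        using m_le[of h N] x L by (intro mult_left_mono) auto
      finally show ?thesis .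
    qed
    have "(\<lambda>n. (u (m h (n\<^sup>2)) - u x) / real (n\<^sup>2)) \<longlonglongrightarrow> 0"
    proof (rule Lim_null_comparison)
      show "\<forall>\<^sub>F n in sequentially. norm ((u (m h (n\<^sup>2)) - u x) / real (n\<^sup>2)) \<le> L * (4 * J) / real n ^ 2"
        using u_bound by (intro always_eventually allI) (simp add: divide_right_mono)
      show "(\<lambda>n. L * (4 * J) / real n ^ 2) \<longlonglongrightarrow> 0" by real_asymp
    qed
    from tendsto_diff[OF elim this]
    have "(\<lambda>n. (\<Sum>k<n\<^sup>2. D k h) / real (n\<^sup>2) - (u (m h (n\<^sup>2)) - u x) / real (n\<^sup>2) + c) \<longlonglongrightarrow> 0 - 0 + c"
      by (intro tendsto_add tendsto_const)
    moreover have "\<forall>\<^sub>F n in sequentially. (\<Sum>k<n\<^sup>2. D k h) / real (n\<^sup>2) - (u (m h (n\<^sup>2)) - u x) / real (n\<^sup>2) + c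
        = total_growth J h x (n\<^sup>2) / real (n\<^sup>2)"
      using eventually_gt_at_top[of 0] by eventually_elim (simp add: sum_D field_simps)
    ultimately have "(\<lambda>n. total_growth J h x (n\<^sup>2) / real (n\<^sup>2)) \<longlonglongrightarrow> 0 - 0 + c"
      by (rule Lim_transform_eventually)
    then show ?case
      by (intro tendsto_along_squares_imp_tendsto mono_total_growth)
         (auto simp: total_growth_def growth_nonneg sum_nonneg)
  qed
qed

text \<open>By \<open>ising_Z_eq_exp\<close> the logarithm of a partition function is half of
  \<open>total_growth\<close> plus a constant, a bounded state and the last field, all negligible
  after division by the length.\<close>

lemma is_free_energy_half_growth_rate:
  assumes J: "0 \<le> J"
    and u: "L-lipschitz_on UNIV u"
    and poisson: "\<And>x. (\<integral>t. growth J (x + 2 * t) \<partial>\<mu>) + (\<integral>t. u (ratio_map J (x + 2 * t)) \<partial>\<mu>) = u x + c"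
  shows "is_free_energy \<mu> J (c / 2)"
proof -
  have start: "\<bar>2 * J * of_int a\<bar> \<le> 2 * J" if "a \<in> {-1, 1}" for a :: int
    using that J by auto
  have "AE h in noise_sequences. \<forall>a\<in>{-1, 1::int}. (\<lambda>N. total_growth J h (2 * J * of_int a) N / real N) \<longlonglongrightarrow> c"
    by (intro AE_finite_allI AE_total_growth[OF J start u poisson]) auto
  then show ?thesis
    unfolding is_free_energy_def noise_sequences_def[symmetric]
    using AE_noise_sublinear
  proof eventually_elim
    case (elim h)
    show ?case
    proof (intro ballI)
      fix a b :: int assume a: "a \<in> {-1, 1}" and b: "b \<in> {-1, 1}"
      define x where "x = 2 * J * of_int a"
      have "(\<lambda>N. total_growth J h x N / real N) \<longlonglongrightarrow> c" unfolding x_def using elim(1) a by blast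
      moreover have "(\<lambda>N. real N / real (Suc N)) \<longlonglongrightarrow> 1" by real_asymp
      ultimately have "(\<lambda>N. total_growth J h x N / real N * (real N / real (Suc N))) \<longlonglongrightarrow> c * 1"
        by (rule tendsto_mult)
      \<comment> \<open>At \<open>N = 0\<close> division by zero gives 0 on the left, and
        \<open>total_growth\<close> is an empty sum on the right.\<close>
      moreover have "total_growth J h x N / real N * (real N / real (Suc N)) = total_growth J h x N / real (Suc N)" for N
        by (cases "N = 0") (simp_all add: total_growth_def)
      ultimately have T: "(\<lambda>N. total_growth J h x N / real (Suc N)) \<longlonglongrightarrow> c" by simp
      have m: "(\<lambda>N. ratio_chain J h x N / real (Suc N)) \<longlonglongrightarrow> 0"
      proof (rule Lim_null_comparison)
        show "\<forall>\<^sub>F N in sequentially. norm (ratio_chain J h x N / real (Suc N)) \<le> 2 * J / real (Suc N)"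
          using abs_ratio_chain_le[OF J start[OF a], of h]
          by (intro always_eventually allI) (simp add: x_def divide_right_mono del: of_nat_Suc)
        show "(\<lambda>N. 2 * J / real (Suc N)) \<longlonglongrightarrow> 0" by real_asymp
      qed
      have J0: "(\<lambda>N. - 2 * J / real (Suc N)) \<longlonglongrightarrow> 0" by real_asymp
      have "(\<lambda>N. (- 2 * J / real (Suc N) + total_growth J h x N / real (Suc N)
          + of_int b * (ratio_chain J h x N / real (Suc N) + 2 * (h (Suc N) / real (Suc N)))) / 2)
          \<longlonglongrightarrow> (0 + c + of_int b * (0 + 2 * 0)) / 2"
        by (intro tendsto_intros T m J0 elim(2)) simp
      moreover have "ln (ising_Z (Suc N) h a b J) / real (Suc N) = (- 2 * J / real (Suc N) + total_growth J h x N / real (Suc N)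
          + of_int b * (ratio_chain J h x N / real (Suc N) + 2 * (h (Suc N) / real (Suc N)))) / 2" for N
        unfolding ising_Z_eq_exp[OF a b] x_def
        by (simp add: add_divide_distrib diff_divide_distrib distrib_left mult.commute del: of_nat_Suc)
      ultimately have "(\<lambda>N. ln (ising_Z (Suc N) h a b J) / real (Suc N)) \<longlonglongrightarrow> (0 + c + of_int b * (0 + 2 * 0)) / 2"
        by (simp only:)
      then have "(\<lambda>N. ln (ising_Z (Suc N) h a b J) / real (Suc N)) \<longlonglongrightarrow> c / 2" by simp
      then show "(\<lambda>N. ln (ising_Z N h a b J) / real N) \<longlonglongrightarrow> c / 2"
        by (rule LIMSEQ_imp_Suc)
    qed
  qed
qed

lemma free_energy_eqI:
  assumes "is_free_energy \<mu> J F"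
  shows "free_energy \<mu> J = F"
  unfolding free_energy_def
proof (rule the_equality[of "is_free_energy \<mu> J", OF assms])
  fix F' assume "is_free_energy \<mu> J F'"
  interpret H: prob_space noise_sequences by (rule prob_space_noise_sequences)
  \<comment> \<open>Both limits hold on a common set of full measure, and an almost sure equality of
    constants on a probability space is an equality.\<close>
  have "AE h in noise_sequences. F' = F"
    using assms \<open>is_free_energy \<mu> J F'\<close> unfolding is_free_energy_def noise_sequences_def[symmetric]
    by eventually_elim (use LIMSEQ_unique in blast)
  then show "F' = F" by simp
qed

theorem free_energy_bounds:
  assumes J: "0 \<le> J" and pos: "0 < second_moment"
  defines "A \<equiv> 2 + 16 / mean_convexity_gain"
    and "B \<equiv> 32 * (\<integral>t. exp \<bar>t\<bar> \<partial>\<mu>) / mean_convexity_gain"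
  shows "2 * second_moment \<le> (4 * J + B) * free_energy \<mu> J"
    and "A \<le> 4 * J \<Longrightarrow> (4 * J - A) * free_energy \<mu> J \<le> 2 * second_moment + (4 * J - A) * exp (- 2 * J)"
proof -
  obtain u c L where u: "L-lipschitz_on UNIV u"
    and poisson: "\<And>x. (\<integral>t. growth J (x + 2 * t) \<partial>\<mu>) + (\<integral>t. u (ratio_map J (x + 2 * t)) \<partial>\<mu>) = u x + c"
    by (rule poisson_equation[OF J]) (rule that)
  have F: "free_energy \<mu> J = c / 2"
    by (intro free_energy_eqI is_free_energy_half_growth_rate[OF J u poisson])
  show "2 * second_moment \<le> (4 * J + B) * free_energy \<mu> J"
    using growth_rate_bounds(1)[OF J pos u poisson] unfolding F B_def by simp
  show "(4 * J - A) * free_energy \<mu> J \<le> 2 * second_moment + (4 * J - A) * exp (- 2 * J)" if "A \<le> 4 * J"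
    using growth_rate_bounds(2)[OF J pos u poisson] that unfolding F A_def by simp
qed

theorem free_energy_asymptotics:
  assumes pos: "0 < second_moment"
  shows "(\<lambda>J. free_energy \<mu> J - second_moment / (2 * J)) \<in> O[at_top](\<lambda>J. 1 / J\<^sup>2)"
proof -
  define A B where "A = 2 + 16 / mean_convexity_gain"
    and "B = 32 * (\<integral>t. exp \<bar>t\<bar> \<partial>\<mu>) / mean_convexity_gain"
  define v where "v = second_moment"
  have gain: "0 < mean_convexity_gain" by (rule mean_convexity_gain_pos[OF pos])
  have A: "0 \<le> A" using gain by (simp add: A_def)
  have B: "0 \<le> B" using gain by (simp add: B_def integral_nonneg_AE)
  have upper: "(\<lambda>J. 2 * v / (4 * J - A) + exp (- 2 * J) - v / (2 * J)) \<in> O[at_top](\<lambda>J. 1 / J\<^sup>2)"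
    by real_asymp
  have lower: "(\<lambda>J. 2 * v / (4 * J + B) - v / (2 * J)) \<in> O[at_top](\<lambda>J. 1 / J\<^sup>2)"
    by real_asymp
  \<comment> \<open>A number between two bounds is no farther from a reference value than the sum of
    the distances of the bounds from it.\<close>
  have "(\<lambda>J. free_energy \<mu> J - v / (2 * J))
      \<in> O[at_top](\<lambda>J. \<bar>2 * v / (4 * J - A) + exp (- 2 * J) - v / (2 * J)\<bar> + \<bar>2 * v / (4 * J + B) - v / (2 * J)\<bar>)"
  proof (rule bigoI[of _ 1])
    show "\<forall>\<^sub>F J in at_top. norm (free_energy \<mu> J - v / (2 * J))
        \<le> 1 * norm (\<bar>2 * v / (4 * J - A) + exp (- 2 * J) - v / (2 * J)\<bar> + \<bar>2 * v / (4 * J + B) - v / (2 * J)\<bar>)"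
      using eventually_gt_at_top[of A] eventually_gt_at_top[of 0]
    proof eventually_elim
      case (elim J)
      have AJ: "0 < 4 * J - A" and BJ: "0 < 4 * J + B" using elim A B by auto
      have "2 * v / (4 * J + B) \<le> free_energy \<mu> J"
        using free_energy_bounds(1)[OF _ pos, of J] BJ elim by (simp add: B_def v_def field_simps)
      moreover have "free_energy \<mu> J \<le> (2 * v + (4 * J - A) * exp (- 2 * J)) / (4 * J - A)"
        using free_energy_bounds(2)[OF _ pos, of J] AJ elim
        by (simp add: A_def v_def pos_le_divide_eq mult.commute)
      moreover have "(2 * v + (4 * J - A) * exp (- 2 * J)) / (4 * J - A) = 2 * v / (4 * J - A) + exp (- 2 * J)"
        using AJ by (simp add: add_divide_distrib)
      ultimately show ?case by (simp add: abs_if split: if_splits)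
    qed
  qed
  also have "(\<lambda>J. \<bar>2 * v / (4 * J - A) + exp (- 2 * J) - v / (2 * J)\<bar> + \<bar>2 * v / (4 * J + B) - v / (2 * J)\<bar>)
      \<in> O[at_top](\<lambda>J. 1 / J\<^sup>2)"
    by (rule sum_in_bigo) (use upper lower in simp_all)
  finally show ?thesis by (simp add: v_def)
qed

end

section \<open>Gaussian noise\<close>

text \<open>Completing the square: exponential tilting moves the mean to
  \<open>s * \<sigma>\<^sup>2\<close>. Exponential moments thereby reduce to integrability of a
  normal density.\<close>

lemma normal_density_times_exp:
  assumes "0 < \<sigma>"
  shows "normal_density 0 \<sigma> x * exp (s * x) = exp (s\<^sup>2 * \<sigma>\<^sup>2 / 2) * normal_density (s * \<sigma>\<^sup>2) \<sigma> x"
proof -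
  have "- x\<^sup>2 / (2 * \<sigma>\<^sup>2) + s * x = s\<^sup>2 * \<sigma>\<^sup>2 / 2 + - (x - s * \<sigma>\<^sup>2)\<^sup>2 / (2 * \<sigma>\<^sup>2)"
    using assms by (simp add: field_simps power2_eq_square)
  then have "exp (- x\<^sup>2 / (2 * \<sigma>\<^sup>2)) * exp (s * x) = exp (s\<^sup>2 * \<sigma>\<^sup>2 / 2) * exp (- (x - s * \<sigma>\<^sup>2)\<^sup>2 / (2 * \<sigma>\<^sup>2))"
    by (simp only: exp_add[symmetric])
  then show ?thesis by (simp add: normal_density_def)
qed

lemma symmetric_noise_gaussian:
  assumes "0 < \<theta>"
  shows "symmetric_noise (centered_gaussian (\<theta>\<^sup>2))"
    and "symmetric_noise.second_moment (centered_gaussian (\<theta>\<^sup>2)) = \<theta>\<^sup>2"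
proof -
  have eq: "centered_gaussian (\<theta>\<^sup>2) = density lborel (\<lambda>x. ennreal (normal_density 0 \<theta> x))"
    using assms by (simp add: centered_gaussian_def)
  interpret G: prob_space "centered_gaussian (\<theta>\<^sup>2)"
    unfolding eq using assms by (rule prob_space_normal_density)
  show noise: "symmetric_noise (centered_gaussian (\<theta>\<^sup>2))"
  proof
    show "sets (centered_gaussian (\<theta>\<^sup>2)) = sets borel" by (simp add: eq)
    have "distributed (centered_gaussian (\<theta>\<^sup>2)) lborel (\<lambda>x. x) (normal_density 0 \<theta>)"
      unfolding distributed_def by (auto simp: eq distr_id2)
    \<comment> \<open>Reflection is the affine map with slope \<open>-1\<close> and shift 0.\<close>
    from G.normal_density_affine[OF this assms, of "-1" 0]
    have "distr (centered_gaussian (\<theta>\<^sup>2)) lborel uminus = centered_gaussian (\<theta>\<^sup>2)"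
      by (simp add: distributed_def eq)
    moreover have "distr (centered_gaussian (\<theta>\<^sup>2)) lborel uminus = distr (centered_gaussian (\<theta>\<^sup>2)) borel uminus"
      by (rule distr_cong) auto
    ultimately show "distr (centered_gaussian (\<theta>\<^sup>2)) borel uminus = centered_gaussian (\<theta>\<^sup>2)" by simp
    have "integrable lborel (\<lambda>x. normal_density 0 \<theta> x * exp (s * x))" for s
      unfolding normal_density_times_exp[OF assms] using assms by auto
    then have "integrable (centered_gaussian (\<theta>\<^sup>2)) (\<lambda>x. exp (s * x))" for s
      unfolding eq by (subst integrable_real_density) auto
    from Bochner_Integration.integrable_add[OF this[of 1] this[of "-1"]]
    show "integrable (centered_gaussian (\<theta>\<^sup>2)) (\<lambda>t. exp \<bar>t\<bar>)"
    proof (rule Bochner_Integration.integrable_bound)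
      show "(\<lambda>t. exp \<bar>t\<bar>) \<in> borel_measurable (centered_gaussian (\<theta>\<^sup>2))"
        unfolding eq by measurable
      have "norm (exp \<bar>t\<bar>) \<le> norm (exp (1 * t) + exp (- 1 * t))" for t :: real
        by (cases "0 \<le> t") (simp_all add: abs_of_pos add_pos_pos)
      then show "AE t in centered_gaussian (\<theta>\<^sup>2). norm (exp \<bar>t\<bar>) \<le> norm (exp (1 * t) + exp (- 1 * t))"
        by simp
    qed
  qed
  have "symmetric_noise.second_moment (centered_gaussian (\<theta>\<^sup>2)) = (\<integral>x. normal_density 0 \<theta> x * x\<^sup>2 \<partial>lborel)"
    unfolding symmetric_noise.second_moment_def[OF noise] unfolding eq by (subst integral_real_density) auto
  also have "\<dots> = \<theta>\<^sup>2"
    using integral_normal_moment_even[OF assms, of 0 1] by simp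
  finally show "symmetric_noise.second_moment (centered_gaussian (\<theta>\<^sup>2)) = \<theta>\<^sup>2" .
qed

theorem theorem1:
  fixes \<theta> :: real
  assumes "\<theta> > 0"
  shows "(\<lambda>J. free_energy (centered_gaussian (\<theta>\<^sup>2)) J - \<theta>\<^sup>2 / (2 * J))
           \<in> O[at_top](\<lambda>J::real. sqrt (ln J) / J\<^sup>2)"
proof -
  interpret symmetric_noise "centered_gaussian (\<theta>\<^sup>2)"
    using assms by (rule symmetric_noise_gaussian)
  have "(\<lambda>J. free_energy (centered_gaussian (\<theta>\<^sup>2)) J - \<theta>\<^sup>2 / (2 * J)) \<in> O[at_top](\<lambda>J. 1 / J\<^sup>2)"
    using free_energy_asymptotics assms by (simp add: symmetric_noise_gaussian)
  also have "(\<lambda>J::real. 1 / J\<^sup>2) \<in> O[at_top](\<lambda>J. sqrt (ln J) / J\<^sup>2)"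
    by real_asymp
  finally show ?thesis .
qed

end
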